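(* Let $d=2$, $\rho>0$, $\beta>0$, and let $H(r)=\exp(-\beta r^{2})$ for $r>0$ and $H(0)=0$. Fix distinct $x,y\in\mathbb{R}^2$ and consider the random connection model $\mathcal{G}_H$ on $\mathcal{Y}^\star=\mathcal{Y}\cup\{x,y\}$. Then the number $\sigma_3$ of three-hop paths from $x$ to $y$ satisfies $$\mathrm{Var}(\sigma_3)=\mathbb{E}\sigma_3+\frac{\pi^3\rho^3}{\beta^3}\left(\frac14\exp\!\Big(-\frac{\beta\|x-y\|^2}{2}\Big)+\frac16\exp\!\Big(-\frac{3\beta\|x-y\|^2}{4}\Big)\right)+\frac{\pi^2\rho^2}{8\beta^2}\exp\!\big(-\beta\|x-y\|^2\big),$$ where $\mathbb{E}\sigma_3=\frac{\pi^2\rho^2}{3\beta^2}\exp\!\big(-\frac{\beta\|x-y\|^2}{3}\big)$.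
   Context: $\mathcal{Y}$ is a homogeneous Poisson point process on $\mathbb{R}^2$ of intensity $\rho$. The random connection model $\mathcal{G}_H$ on $\mathcal{Y}^\star=\mathcal{Y}\cup\{x,y\}$ is the random graph obtained, conditionally on $\mathcal{Y}$, by joining each unordered pair of distinct points $u,v\in\mathcal{Y}^\star$ by an edge independently with probability $H(\|u-v\|)$ (no self-loops), $\|\cdot\|$ the Euclidean norm. A three-hop path from $x$ to $y$ is an ordered pair $(A,B)$ of distinct points of $\mathcal{Y}$ such that $x\sim A$, $A\sim B$, $B\sim y$ in $\mathcal{G}_H$; $\sigma_3$ is the number of such paths. *)

theory Defs
  imports "HOL-Probability.Probability"
begin

definition gaussH :: "real \<Rightarrow> real \<Rightarrow> real" where
  "gaussH \<beta> r = (if r > 0 then exp (- \<beta> * r\<^sup>2) else 0)"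

definition pp_count :: "(nat \<Rightarrow> real^2) \<Rightarrow> (real^2) set \<Rightarrow> nat" where
  "pp_count X B = card {i. X i \<in> B}"

text \<open>Homogeneous Poisson point process of intensity rho on R^2, given as a
  random enumeration X of its (a.s. infinitely many, distinct) points:
  counts in bounded Borel sets are a.s. finite and Poisson(rho * Lebesgue(B)),
  and counts in finitely many pairwise disjoint bounded Borel sets are independent.\<close>
definition (in prob_space) poisson_pp :: "real \<Rightarrow> (nat \<Rightarrow> 'a \<Rightarrow> real^2) \<Rightarrow> bool" where
  "poisson_pp \<rho> X \<longleftrightarrow>
     (\<lambda>\<omega> i. X i \<omega>) \<in> measurable M (PiM UNIV (\<lambda>_. borel)) \<and>
     (AE \<omega> in M. inj (\<lambda>i. X i \<omega>)) \<and>
     (\<forall>B. B \<in> sets borel \<and> bounded B \<longrightarrow>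
        (AE \<omega> in M. finite {i. X i \<omega> \<in> B}) \<and>
        (\<forall>n. prob {\<omega> \<in> space M. pp_count (\<lambda>i. X i \<omega>) B = n}
               = exp (- (\<rho> * measure lborel B)) * (\<rho> * measure lborel B) ^ n / fact n)) \<and>
     (\<forall>(J::nat set) B. finite J \<longrightarrow> disjoint_family_on B J \<longrightarrow>
        (\<forall>j\<in>J. B j \<in> sets borel \<and> bounded (B j)) \<longrightarrow>
        indep_vars (\<lambda>_. count_space UNIV) (\<lambda>j \<omega>. pp_count (\<lambda>i. X i \<omega>) (B j)) J)"

text \<open>Indices of the independent uniform marks used to realise the edges:
  Ue i j (i < j) for the pair of points X i, X j; Ux i for x ~ X i; Uy i for X i ~ y.\<close>
datatype mark_idx = Ue nat nat | Ux nat | Uy nat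

text \<open>Random connection model on Y \<union> {x,y}: the marks U are i.i.d. uniform on
  [0,1], jointly independent of the point process, and two vertices u, v are
  joined iff their mark is < H(|u - v|); hence conditionally on Y the edges are
  independent with probability H(|u - v|).\<close>
definition (in prob_space) rcm_marks :: "(nat \<Rightarrow> 'a \<Rightarrow> real^2) \<Rightarrow> (mark_idx \<Rightarrow> 'a \<Rightarrow> real) \<Rightarrow> bool" where
  "rcm_marks X U \<longleftrightarrow>
     indep_vars (\<lambda>_. borel) U UNIV \<and>
     (\<forall>k. distributed M lborel (U k) (indicator {0..1})) \<and>
     (\<lambda>\<omega> k. U k \<omega>) \<in> measurable M (PiM UNIV (\<lambda>_. borel)) \<and>
     indep_set
       (sigma_sets (space M) {(\<lambda>\<omega> i. X i \<omega>) -` A \<inter> space M | A. A \<in> sets (PiM (UNIV::nat set) (\<lambda>_. borel))})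
       (sigma_sets (space M) {(\<lambda>\<omega> k. U k \<omega>) -` A \<inter> space M | A. A \<in> sets (PiM (UNIV::mark_idx set) (\<lambda>_. borel))})"

definition edge_pts :: "real \<Rightarrow> (mark_idx \<Rightarrow> 'a \<Rightarrow> real) \<Rightarrow> (nat \<Rightarrow> 'a \<Rightarrow> real^2) \<Rightarrow> nat \<Rightarrow> nat \<Rightarrow> 'a \<Rightarrow> bool" where
  "edge_pts \<beta> U X i j \<omega> \<longleftrightarrow> U (Ue (min i j) (max i j)) \<omega> < gaussH \<beta> (norm (X i \<omega> - X j \<omega>))"

definition sigma3 :: "real \<Rightarrow> real^2 \<Rightarrow> real^2 \<Rightarrow> (nat \<Rightarrow> 'a \<Rightarrow> real^2) \<Rightarrow> (mark_idx \<Rightarrow> 'a \<Rightarrow> real) \<Rightarrow> 'a \<Rightarrow> real" where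
  "sigma3 \<beta> x y X U \<omega> = real (card {(i, j). i \<noteq> j \<and>
      U (Ux i) \<omega> < gaussH \<beta> (norm (x - X i \<omega>)) \<and>
      edge_pts \<beta> U X i j \<omega> \<and>
      U (Uy j) \<omega> < gaussH \<beta> (norm (X j \<omega> - y))})"

end

theory Submission
  imports Defs
begin

text \<open>
  By independence, the \<open>n\<close>-th factorial moment measure of the point process and the \<open>n\<close>-fold product of its
  intensity measure agree on boxes with pairwise disjoint bounded sides. These boxes generate the Borel sets of
  tuples of distinct points, and both measures live on such tuples, so they coincide. Hence the expected sum of
  a function over tuples of distinct points is an iterated integral, and averaging over the marks replaces the
  indicator that certain edges are present by the product of their connection probabilities.

  The square of the number of paths is a sum over pairs of paths \<open>(i, j)\<close>, \<open>(k, l)\<close>, and there are seven ways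
  in which their vertices can coincide. Disjoint pairs contribute the square of the mean and equal pairs the
  mean. The other five cases are Gaussian integrals over two or three points of the plane.
\<close>

section \<open>Iterated integrals\<close>

primrec iterated_nn_integral :: "'a measure \<Rightarrow> nat \<Rightarrow> ('a list \<Rightarrow> ennreal) \<Rightarrow> ennreal" where
  "iterated_nn_integral M 0 f = f []"
| "iterated_nn_integral M (Suc n) f = (\<integral>\<^sup>+ z. iterated_nn_integral M n (\<lambda>zs. f (z # zs)) \<partial>M)"

lemma (in sigma_finite_measure) nn_integral_PiM_eq_iterated_nn_integral:
  fixes js :: "'i list"
  assumes "distinct js" and "(\<lambda>x. f (map x js)) \<in> borel_measurable (PiM (set js) (\<lambda>_. M))"
  shows "(\<integral>\<^sup>+ x. f (map x js) \<partial>PiM (set js) (\<lambda>_. M)) = iterated_nn_integral M (length js) f"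
  using assms
proof (induction js arbitrary: f)
  case Nil
  interpret product_sigma_finite "\<lambda>_. M" ..
  show ?case by (simp add: PiM_empty nn_integral_count_space_finite)
next
  case (Cons j js)
  interpret product_sigma_finite "\<lambda>_. M" ..
  have j: "j \<notin> set js" and js: "distinct js"
    and f: "(\<lambda>x. f (map x (j # js))) \<in> borel_measurable (PiM (insert j (set js)) (\<lambda>_. M))"
    using Cons.prems by simp_all
  have map_upd: "map (x(j := z)) (j # js) = z # map x js" for x z
    using j by simp
  have "(\<integral>\<^sup>+ x. f (map x (j # js)) \<partial>PiM (set (j # js)) (\<lambda>_. M))
      = (\<integral>\<^sup>+ z. \<integral>\<^sup>+ x. f (z # map x js) \<partial>PiM (set js) (\<lambda>_. M) \<partial>M)"
    using product_nn_integral_insert_rev[OF _ j f] by (simp only: map_upd list.set finite_set)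
  also have "\<dots> = (\<integral>\<^sup>+ z. iterated_nn_integral M (length js) (\<lambda>zs. f (z # zs)) \<partial>M)"
  proof (rule nn_integral_cong, rule Cons.IH[OF js])
    fix z assume "z \<in> space M"
    then have "(\<lambda>x. x(j := z)) \<in> measurable (PiM (set js) (\<lambda>_. M)) (PiM (insert j (set js)) (\<lambda>_. M))"
      by measurable
    from measurable_compose[OF this f] show "(\<lambda>x. f (z # map x js)) \<in> borel_measurable (PiM (set js) (\<lambda>_. M))"
      by (simp only: map_upd)
  qed
  finally show ?case by simp
qed

section \<open>Counting lists\<close>

abbreviation ecard :: "'a set \<Rightarrow> ennreal" where
  "ecard A \<equiv> emeasure (count_space UNIV) A"

lemma emeasure_Collect_eq_nn_integral:
  assumes "Measurable.pred M P"
  shows "emeasure M {\<omega> \<in> space M. P \<omega>} = (\<integral>\<^sup>+ \<omega>. of_bool (P \<omega>) \<partial>M)"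
proof -
  have "emeasure M {\<omega> \<in> space M. P \<omega>} = (\<integral>\<^sup>+ \<omega>. indicator {\<omega> \<in> space M. P \<omega>} \<omega> \<partial>M)"
    using assms by (intro nn_integral_indicator[symmetric]) (simp add: pred_def)
  also have "\<dots> = (\<integral>\<^sup>+ \<omega>. of_bool (P \<omega>) \<partial>M)"
    by (intro nn_integral_cong) (simp add: indicator_def)
  finally show ?thesis .
qed

lemma ecard_Collect_eq_nn_integral: "ecard {a \<in> A. P a} = (\<integral>\<^sup>+ a. of_bool (P a) \<partial>count_space A)"
proof -
  have "ecard {a \<in> A. P a} = emeasure (count_space A) {a \<in> space (count_space A). P a}"
    by (simp add: emeasure_count_space)
  then show ?thesis
    by (subst (asm) emeasure_Collect_eq_nn_integral) simp_all
qed

lemma ecard_image: "inj_on f A \<Longrightarrow> ecard (f ` A) = ecard A"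
  by (simp add: emeasure_count_space finite_image_iff card_image)

lemma ecard_Collect_image: "inj_on f A \<Longrightarrow> ecard {a \<in> A. P (f a)} = ecard {b \<in> f ` A. P b}"
proof -
  assume "inj_on f A"
  then have "ecard (f ` {a \<in> A. P (f a)}) = ecard {a \<in> A. P (f a)}"
    by (intro ecard_image) (auto intro: inj_on_subset)
  moreover have "f ` {a \<in> A. P (f a)} = {b \<in> f ` A. P b}"
    by auto
  ultimately show ?thesis by simp
qed

lemma ecard_Un_disjoint: "A \<inter> B = {} \<Longrightarrow> ecard (A \<union> B) = ecard A + ecard B"
  by (rule plus_emeasure[symmetric]) simp_all

lemma ecard_Times: "ecard (A \<times> B) = ecard A * ecard B" for A :: "'a::countable set" and B :: "'b::countable set"
proof -
  interpret sigma_finite_measure "count_space (UNIV :: 'b set)"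
    by (rule sigma_finite_measure_count_space)
  show ?thesis
    using emeasure_pair_measure_Times[of A "count_space UNIV" B] by (simp add: pair_measure_countable)
qed

lemma ecard_lists_nth:
  fixes A :: "nat \<Rightarrow> 'a::countable set"
  shows "ecard {xs. length xs = n \<and> (\<forall>i<n. xs ! i \<in> A i)} = (\<Prod>i<n. ecard (A i))"
proof (induction n arbitrary: A)
  case 0
  have "{xs :: 'a list. length xs = 0 \<and> (\<forall>i<0. xs ! i \<in> A i)} = {[]}"
    by auto
  then show ?case by simp
next
  case (Suc n)
  have "{xs. length xs = Suc n \<and> (\<forall>i<Suc n. xs ! i \<in> A i)}
      = (\<lambda>(x, xs). x # xs) ` (A 0 \<times> {xs. length xs = n \<and> (\<forall>i<n. xs ! i \<in> A (Suc i))})"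
    by (auto simp: length_Suc_conv All_less_Suc2)
  then show ?case
    by (simp add: ecard_image inj_on_def ecard_Times Suc.IH[of "\<lambda>i. A (Suc i)"] prod.lessThan_Suc_shift
        del: prod.lessThan_Suc)
qed

definition distinct_lists :: "nat \<Rightarrow> 'a list set" where
  "distinct_lists n = {xs. length xs = n \<and> distinct xs}"

lemma ecard_distinct_lists_nth:
  fixes A :: "nat \<Rightarrow> 'a::countable set"
  assumes "disjoint_family_on A {..<n}"
  shows "ecard {xs \<in> distinct_lists n. \<forall>i<n. xs ! i \<in> A i} = (\<Prod>i<n. ecard (A i))"
proof -
  have "distinct xs" if "length xs = n" "\<forall>i<n. xs ! i \<in> A i" for xs
    unfolding distinct_conv_nth
  proof (intro allI impI)
    fix i j assume ij: "i < length xs" "j < length xs" "i \<noteq> j"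
    then have "A i \<inter> A j = {}"
      using assms that(1) by (auto simp: disjoint_family_on_def)
    then show "xs ! i \<noteq> xs ! j"
      using that ij by (metis disjoint_iff)
  qed
  then have "{xs \<in> distinct_lists n. \<forall>i<n. xs ! i \<in> A i} = {xs. length xs = n \<and> (\<forall>i<n. xs ! i \<in> A i)}"
    by (auto simp: distinct_lists_def)
  then show ?thesis
    by (simp only: ecard_lists_nth)
qed

lemma image_distinct_lists_2: "f ` distinct_lists 2 = {f [i, j] | i j. i \<noteq> j}"
  unfolding distinct_lists_def by (auto simp: numeral_eq_Suc length_Suc_conv) blast

lemma image_distinct_lists_3: "f ` distinct_lists 3 = {f [i, j, k] | i j k. distinct [i, j, k]}"
  unfolding distinct_lists_def by (auto simp: numeral_eq_Suc length_Suc_conv) blast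

lemma image_distinct_lists_4: "f ` distinct_lists 4 = {f [i, j, k, l] | i j k l. distinct [i, j, k, l]}"
  unfolding distinct_lists_def by (auto simp: numeral_eq_Suc length_Suc_conv) blast

section \<open>Measures on tuples of distinct points\<close>

definition injections :: "'i set \<Rightarrow> ('i \<Rightarrow> 'b) set" where
  "injections I = {x \<in> extensional I. inj_on x I}"

definition disjoint_boxes :: "'i set \<Rightarrow> ('i \<Rightarrow> 'b::metric_space) set set" where
  "disjoint_boxes I = {PiE I B | B. (\<forall>i\<in>I. B i \<in> sets borel \<and> bounded (B i)) \<and> disjoint_family_on B I}"

lemma disjoint_boxesI:
  assumes "\<And>i. i \<in> I \<Longrightarrow> B i \<in> sets borel" "\<And>i. i \<in> I \<Longrightarrow> bounded (B i)" "disjoint_family_on B I"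
  shows "PiE I B \<in> disjoint_boxes I"
  unfolding disjoint_boxes_def using assms by blast

lemma disjoint_boxes_Int_PiE:
  assumes "X \<in> disjoint_boxes I" and "\<And>i. i \<in> I \<Longrightarrow> A i \<in> sets borel"
  shows "X \<inter> PiE I A \<in> disjoint_boxes I"
proof -
  obtain B where B: "X = PiE I B" "\<forall>i\<in>I. B i \<in> sets borel \<and> bounded (B i)" "disjoint_family_on B I"
    using assms(1) unfolding disjoint_boxes_def by auto
  have "disjoint_family_on (\<lambda>i. B i \<inter> A i) I"
    using B(3) unfolding disjoint_family_on_def by blast
  then show ?thesis
    unfolding B(1) PiE_Int using B(2) assms(2) by (intro disjoint_boxesI) (auto intro: bounded_Int)
qed

lemma Int_stable_disjoint_boxes: "Int_stable (disjoint_boxes I)"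
proof (rule Int_stableI)
  fix X Y :: "('a \<Rightarrow> 'b) set" assume X: "X \<in> disjoint_boxes I" and "Y \<in> disjoint_boxes I"
  then obtain A where "Y = PiE I A" "\<And>i. i \<in> I \<Longrightarrow> A i \<in> sets borel"
    unfolding disjoint_boxes_def by auto
  then show "X \<inter> Y \<in> disjoint_boxes I"
    using disjoint_boxes_Int_PiE[OF X] by simp
qed

lemma disjoint_boxes_subset_injections:
  assumes "X \<in> disjoint_boxes I"
  shows "X \<subseteq> injections I"
proof
  fix x assume "x \<in> X"
  moreover obtain B where B: "X = PiE I B" "disjoint_family_on B I"
    using assms by (auto simp: disjoint_boxes_def)
  moreover have "x i \<noteq> x j" if "x \<in> PiE I B" "i \<in> I" "j \<in> I" "i \<noteq> j" for i j
    using disjoint_family_onD[OF B(2) that(2-4)] that(1-3) by (metis PiE_mem disjoint_iff)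
  ultimately show "x \<in> injections I"
    unfolding injections_def inj_on_def by (auto simp: PiE_iff)
qed

lemma injections_in_sets_PiM:
  fixes I :: "'i set"
  assumes "finite I"
  shows "(injections I :: ('i \<Rightarrow> 'b::{metric_space, second_countable_topology}) set) \<in> sets (PiM I (\<lambda>_. borel))"
proof -
  have "Measurable.pred (PiM I (\<lambda>_. borel :: 'b measure)) (\<lambda>x. \<forall>i\<in>I. \<forall>j\<in>I. dist (x i) (x j) = 0 \<longrightarrow> i = j)"
    using assms by measurable
  then show ?thesis
    by (simp add: injections_def inj_on_def pred_def space_PiM PiE_def)
qed

lemma disjoint_balls_of_inj_on:
  fixes x :: "'i \<Rightarrow> 'b::metric_space"
  assumes "finite I" and "inj_on x I"
  obtains r where "r > 0" "disjoint_family_on (\<lambda>i. ball (x i) r) I"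
proof -
  define D where "D = insert 1 ((\<lambda>(i, j). dist (x i) (x j)) ` {(i, j) \<in> I \<times> I. i \<noteq> j})"
  have finite_D: "finite D"
    unfolding D_def
    by (intro finite.insertI finite_imageI, rule finite_subset[of _ "I \<times> I"]) (use assms(1) in auto)
  have "ball (x i) (Min D / 2) \<inter> ball (x j) (Min D / 2) = {}" if "i \<in> I" "j \<in> I" "i \<noteq> j" for i j
  proof -
    have "dist (x i) (x j) \<in> D"
      unfolding D_def using that by force
    then show ?thesis
      using Min_le[OF finite_D] by (intro disjoint_ballI) simp
  qed
  moreover have "Min D > 0"
    using assms(2) finite_D by (subst Min_gr_iff) (auto simp: D_def inj_on_def)
  ultimately show ?thesis
    by (intro that[of "Min D / 2"]) (simp_all add: disjoint_family_on_def)
qed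

lemma disjoint_basic_box_around_injection:
  fixes x :: "'i \<Rightarrow> 'b::metric_space"
  assumes "finite I" and basis: "topological_basis \<K>" and x: "x \<in> injections I"
  obtains B where "B \<in> PiE I (\<lambda>_. \<K>)" "\<forall>i\<in>I. bounded (B i)" "disjoint_family_on B I" "x \<in> PiE I B"
proof -
  obtain r where r: "r > 0" "disjoint_family_on (\<lambda>i. ball (x i) r) I"
    using disjoint_balls_of_inj_on[OF assms(1)] x by (auto simp: injections_def)
  have "\<exists>B. B \<in> \<K> \<and> x i \<in> B \<and> B \<subseteq> ball (x i) r" for i
    using topological_basisE[OF basis open_ball, of "x i" "x i" r] r(1) by (metis centre_in_ball)
  then obtain B where B: "\<And>i. B i \<in> \<K>" "\<And>i. x i \<in> B i" "\<And>i. B i \<subseteq> ball (x i) r"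
    by metis
  show thesis
  proof
    show "restrict B I \<in> PiE I (\<lambda>_. \<K>)"
      using B(1) by simp
    show "\<forall>i\<in>I. bounded (restrict B I i)"
      using bounded_subset[OF bounded_ball B(3)] by simp
    show "disjoint_family_on (restrict B I) I"
      using disjoint_family_on_bisimulation[OF r(2), of "restrict B I"] B(3)
      by (simp add: disjoint_iff subset_iff) blast
    show "x \<in> PiE I (restrict B I)"
      using x B(2) by (simp add: injections_def PiE_iff)
  qed
qed

lemma countable_disjoint_boxes_cover_injections:
  fixes I :: "'i set"
  assumes "finite I"
  obtains \<C> :: "('i \<Rightarrow> 'b::{metric_space, second_countable_topology}) set set"
    where "countable \<C>" "\<C> \<noteq> {}" "\<C> \<subseteq> disjoint_boxes I" "\<Union>\<C> = injections I"
proof -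
  obtain \<K> :: "'b set set" where \<K>: "countable \<K>" "topological_basis \<K>"
    using ex_countable_basis by blast
  \<comment> \<open>The box with empty sides only serves to make the family nonempty.\<close>
  define \<C> where "\<C> = insert (PiE I (\<lambda>_. {}))
    (PiE I ` {B \<in> PiE I (\<lambda>_. \<K>). (\<forall>i\<in>I. bounded (B i)) \<and> disjoint_family_on B I})"
  have boxes: "\<C> \<subseteq> disjoint_boxes I"
  proof -
    have "PiE I (\<lambda>_. {}) \<in> disjoint_boxes I"
      by (rule disjoint_boxesI) (simp_all add: disjoint_family_on_def)
    moreover have "PiE I B \<in> disjoint_boxes I"
      if "B \<in> PiE I (\<lambda>_. \<K>)" "\<forall>i\<in>I. bounded (B i)" "disjoint_family_on B I" for B
      using that topological_basis_open[OF \<K>(2)] by (intro disjoint_boxesI) (auto simp: PiE_iff)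
    ultimately show ?thesis
      unfolding \<C>_def by auto
  qed
  show thesis
  proof
    show "countable \<C>"
      unfolding \<C>_def
      by (intro countable_insert countable_image countable_Collect countable_PiE assms \<K>(1))
    show "\<C> \<noteq> {}"
      by (simp add: \<C>_def)
    have "x \<in> \<Union>\<C>" if x: "x \<in> injections I" for x
    proof -
      obtain B where B: "B \<in> PiE I (\<lambda>_. \<K>)" "\<forall>i\<in>I. bounded (B i)" "disjoint_family_on B I" "x \<in> PiE I B"
        by (rule disjoint_basic_box_around_injection[OF assms \<K>(2) x])
      then have "PiE I B \<in> \<C>"
        unfolding \<C>_def by (intro insertI2 imageI CollectI conjI)
      then show ?thesis
        using B(4) by (rule UnionI)
    qed
    moreover have "\<Union>\<C> \<subseteq> injections I"
      using boxes disjoint_boxes_subset_injections by blast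
    ultimately show "\<Union>\<C> = injections I"
      by blast
  qed (fact boxes)
qed

lemma sets_restrict_space_PiM_injections:
  fixes I :: "'i set"
  assumes "finite I"
  shows "sets (restrict_space (PiM I (\<lambda>_. borel)) (injections I))
    = sigma_sets (injections I :: ('i \<Rightarrow> 'b::{metric_space, second_countable_topology}) set) (disjoint_boxes I)"
proof -
  let ?\<Omega> = "injections I :: ('i \<Rightarrow> 'b) set" and ?borel = "\<lambda>_::'i. borel :: 'b measure"
  obtain \<C> :: "('i \<Rightarrow> 'b) set set" where \<C>: "countable \<C>" "\<C> \<noteq> {}" "\<C> \<subseteq> disjoint_boxes I" "\<Union>\<C> = ?\<Omega>"
    by (rule countable_disjoint_boxes_cover_injections[OF assms])
  have "sets (restrict_space (PiM I ?borel) ?\<Omega>) = sigma_sets ?\<Omega> ((\<inter>) ?\<Omega> ` prod_algebra I ?borel)"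
    unfolding sets_restrict_space sets_PiM
    by (rule sigma_sets_Int)
      (use injections_in_sets_PiM[OF assms] in \<open>auto simp: sets_PiM injections_def PiE_def\<close>)
  also have "\<dots> = sigma_sets ?\<Omega> (disjoint_boxes I)"
  proof (rule sigma_sets_eqI)
    fix X assume "X \<in> (\<inter>) ?\<Omega> ` prod_algebra I ?borel"
    then obtain A where A: "X = ?\<Omega> \<inter> PiE I A" "\<And>i. i \<in> I \<Longrightarrow> A i \<in> sets borel"
      by (auto simp: prod_algebra_eq_finite[OF assms])
    have "C \<inter> PiE I A \<in> disjoint_boxes I" if "C \<in> \<C>" for C
      using \<C>(3) that A(2) by (intro disjoint_boxes_Int_PiE) auto
    moreover have "X = (\<Union>C\<in>\<C>. C \<inter> PiE I A)"
      using \<C>(4) A(1) by auto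
    ultimately show "X \<in> sigma_sets ?\<Omega> (disjoint_boxes I)"
      using \<C>(1) by (simp only:) (rule sigma_sets_UNION, auto)
  next
    fix X :: "('i \<Rightarrow> 'b) set" assume X: "X \<in> disjoint_boxes I"
    then have "X \<in> prod_algebra I ?borel"
      by (auto simp: disjoint_boxes_def prod_algebra_eq_finite[OF assms])
    then have "?\<Omega> \<inter> X \<in> sigma_sets ?\<Omega> ((\<inter>) ?\<Omega> ` prod_algebra I ?borel)"
      by (intro sigma_sets.Basic imageI)
    then show "X \<in> sigma_sets ?\<Omega> ((\<inter>) ?\<Omega> ` prod_algebra I ?borel)"
      using disjoint_boxes_subset_injections[OF X] by (simp add: Int_absorb1)
  qed
  finally show ?thesis .
qed

theorem measure_eqI_disjoint_boxes:
  fixes \<mu> \<nu> :: "('i \<Rightarrow> 'b::{metric_space, second_countable_topology}) measure"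
  assumes "finite I" and sets: "sets \<mu> = sets (PiM I (\<lambda>_. borel))" "sets \<nu> = sets (PiM I (\<lambda>_. borel))"
    and eq: "\<And>X. X \<in> disjoint_boxes I \<Longrightarrow> emeasure \<mu> X = emeasure \<nu> X"
    and finite: "\<And>X. X \<in> disjoint_boxes I \<Longrightarrow> emeasure \<nu> X \<noteq> \<infinity>"
    and AE: "AE x in \<mu>. inj_on x I" "AE x in \<nu>. inj_on x I"
  shows "\<mu> = \<nu>"
proof -
  obtain \<C> :: "('i \<Rightarrow> 'b) set set"
    where \<C>: "countable \<C>" "\<C> \<noteq> {}" "\<C> \<subseteq> disjoint_boxes I" "\<Union>\<C> = injections I"
    by (rule countable_disjoint_boxes_cover_injections[OF assms(1)])
  have AE_injections: "AE x in M. x \<in> injections I"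
    if "sets M = sets (PiM I (\<lambda>_. borel))" "AE x in M. inj_on x I" for M :: "('i \<Rightarrow> 'b) measure"
    using that(2) AE_space
    by eventually_elim (simp add: sets_eq_imp_space_eq[OF that(1)] injections_def space_PiM PiE_def)
  have restrict: "sets (restrict_space M (injections I)) = sigma_sets (injections I) (disjoint_boxes I)"
    if "sets M = sets (PiM I (\<lambda>_. borel))" for M :: "('i \<Rightarrow> 'b) measure"
    using sets_restrict_space_PiM_injections[OF assms(1)] sets_restrict_space_cong[OF that] by simp
  show ?thesis
  proof (rule measure_eqI_restrict_generator[where \<Omega>="injections I" and E="disjoint_boxes I"])
    show "disjoint_boxes I \<subseteq> Pow (injections I)"
      using disjoint_boxes_subset_injections by blast
    show "\<And>X. X \<in> \<C> \<Longrightarrow> emeasure \<mu> X \<noteq> \<infinity>"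
      using finite eq \<C>(3) by (metis subsetD)
  qed (use assms(1) sets \<C> in \<open>simp_all add: Int_stable_disjoint_boxes injections_in_sets_PiM
      restrict AE_injections AE eq\<close>)
qed

lemma AE_PiM_inj_on:
  fixes \<nu> :: "'b::{metric_space, second_countable_topology} measure"
  assumes "sigma_finite_measure \<nu>" and sets: "sets \<nu> = sets borel" and diffuse: "\<And>z. emeasure \<nu> {z} = 0"
    and "finite I"
  shows "AE x in PiM I (\<lambda>_. \<nu>). inj_on x I"
proof -
  interpret product_sigma_finite "\<lambda>_. \<nu>"
    by (intro product_sigma_finite.intro assms(1))
  let ?\<pi> = "PiM I (\<lambda>_. \<nu>)"
  have "AE x in ?\<pi>. dist (x i) (x j) \<noteq> 0" if ij: "i \<in> I" "j \<in> I" "i \<noteq> j" for i j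
  proof -
    have [measurable]: "(\<lambda>x. x k) \<in> measurable ?\<pi> borel" if "k \<in> I" for k
      using measurable_component_singleton[OF that, of "\<lambda>_. \<nu>"] by (simp add: measurable_cong_sets[OF refl sets])
    let ?D = "{x \<in> space ?\<pi>. dist (x i) (x j) = 0}"
    have D: "?D \<in> sets ?\<pi>"
      using ij by measurable
    have I: "insert i (I - {i}) = I" using ij by auto
    have "emeasure ?\<pi> ?D = (\<integral>\<^sup>+ x. \<integral>\<^sup>+ z. indicator ?D (x(i := z)) \<partial>\<nu> \<partial>PiM (I - {i}) (\<lambda>_. \<nu>))"
      using product_nn_integral_insert[of "I - {i}" i "indicator ?D"] D \<open>finite I\<close> by (simp only: I) simp
    also have "\<dots> \<le> (\<integral>\<^sup>+ x. \<integral>\<^sup>+ z. indicator {x j} z \<partial>\<nu> \<partial>PiM (I - {i}) (\<lambda>_. \<nu>))"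
      using ij by (intro nn_integral_mono) (auto split: split_indicator)
    also have "\<dots> = 0"
      by (simp add: sets diffuse)
    finally show ?thesis
      using D by (subst AE_iff_measurable[OF _ refl]) simp_all
  qed
  then have "AE x in ?\<pi>. \<forall>i\<in>I. \<forall>j\<in>I. i \<noteq> j \<longrightarrow> dist (x i) (x j) \<noteq> 0"
    using \<open>finite I\<close> by (intro AE_finite_allI) auto
  then show ?thesis
    by eventually_elim (auto simp: inj_on_def)
qed

section \<open>Factorial moment measures of a Poisson process\<close>

definition factorial_moment_measure ::
    "'a measure \<Rightarrow> nat \<Rightarrow> (nat \<Rightarrow> 'a \<Rightarrow> 'b::topological_space) \<Rightarrow> (nat \<Rightarrow> 'b) measure" where
  "factorial_moment_measure M n X = distr (count_space (distinct_lists n) \<Otimes>\<^sub>M M) (PiM {..<n} (\<lambda>_. borel))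
     (\<lambda>(js, \<omega>). \<lambda>i\<in>{..<n}. X (js ! i) \<omega>)"

lemma sets_factorial_moment_measure [simp, measurable_cong]:
  "sets (factorial_moment_measure M n X) = sets (PiM {..<n} (\<lambda>_. borel))"
  by (simp add: factorial_moment_measure_def)

lemma (in sigma_finite_measure) nn_integral_factorial_moment_measure:
  assumes [measurable]: "\<And>i. X i \<in> borel_measurable M" "f \<in> borel_measurable (PiM {..<n} (\<lambda>_. borel))"
  shows "integral\<^sup>N (factorial_moment_measure M n X) f
    = (\<integral>\<^sup>+ \<omega>. \<integral>\<^sup>+ js. f (\<lambda>i\<in>{..<n}. X (js ! i) \<omega>) \<partial>count_space (distinct_lists n) \<partial>M)"
proof -
  have [measurable]: "(\<lambda>(js, \<omega>). \<lambda>i\<in>{..<n}. X (js ! i) \<omega>)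
      \<in> measurable (count_space (distinct_lists n) \<Otimes>\<^sub>M M) (PiM {..<n} (\<lambda>_. borel))"
    by (rule measurable_pair_measure_countable1) (simp_all)
  have "integral\<^sup>N (factorial_moment_measure M n X) f
      = (\<integral>\<^sup>+ js. \<integral>\<^sup>+ \<omega>. f (\<lambda>i\<in>{..<n}. X (js ! i) \<omega>) \<partial>M \<partial>count_space (distinct_lists n))"
    unfolding factorial_moment_measure_def
    by (subst nn_integral_distr, simp, simp, subst nn_integral_fst[symmetric], simp_all)
  also have "\<dots> = (\<integral>\<^sup>+ \<omega>. \<integral>\<^sup>+ js. f (\<lambda>i\<in>{..<n}. X (js ! i) \<omega>) \<partial>count_space (distinct_lists n) \<partial>M)"
    by (rule nn_integral_count_space_nn_integral[symmetric]) (simp_all)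
  finally show ?thesis .
qed

lemma (in sigma_finite_measure) emeasure_factorial_moment_measure_PiE:
  assumes X: "\<And>i. X i \<in> borel_measurable M" and B: "\<And>i. i < n \<Longrightarrow> B i \<in> sets borel"
    and disjoint: "disjoint_family_on B {..<n}"
  shows "emeasure (factorial_moment_measure M n X) (PiE {..<n} B) = (\<integral>\<^sup>+ \<omega>. (\<Prod>i<n. ecard {k. X k \<omega> \<in> B i}) \<partial>M)"
proof -
  have [measurable]: "PiE {..<n} B \<in> sets (PiM {..<n} (\<lambda>_. borel))"
    using B by (intro sets_PiM_I_finite) auto
  have "emeasure (factorial_moment_measure M n X) (PiE {..<n} B)
      = integral\<^sup>N (factorial_moment_measure M n X) (indicator (PiE {..<n} B))"
    by simp
  also have "\<dots> = (\<integral>\<^sup>+ \<omega>. \<integral>\<^sup>+ js. indicator (PiE {..<n} B) (\<lambda>i\<in>{..<n}. X (js ! i) \<omega>)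
      \<partial>count_space (distinct_lists n) \<partial>M)"
    by (rule nn_integral_factorial_moment_measure[OF X]) simp
  also have "\<dots> = (\<integral>\<^sup>+ \<omega>. ecard {js \<in> distinct_lists n. \<forall>i<n. js ! i \<in> {k. X k \<omega> \<in> B i}} \<partial>M)"
    unfolding ecard_Collect_eq_nn_integral
    by (intro nn_integral_cong) (auto simp: indicator_def PiE_iff)
  also have "\<dots> = (\<integral>\<^sup>+ \<omega>. (\<Prod>i<n. ecard {k. X k \<omega> \<in> B i}) \<partial>M)"
  proof (intro nn_integral_cong ecard_distinct_lists_nth)
    show "disjoint_family_on (\<lambda>i. {k. X k \<omega> \<in> B i}) {..<n}" for \<omega>
      using disjoint unfolding disjoint_family_on_def by blast
  qed
  finally show ?thesis .
qed

lemma (in sigma_finite_measure) AE_factorial_moment_measure_inj_on: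
  fixes X :: "nat \<Rightarrow> 'a \<Rightarrow> 'b::{metric_space, second_countable_topology}"
  assumes X: "\<And>i. X i \<in> borel_measurable M" and inj: "AE \<omega> in M. inj (\<lambda>i. X i \<omega>)"
  shows "AE x in factorial_moment_measure M n X. inj_on x {..<n}"
proof (rule AE_I)
  let ?F = "factorial_moment_measure M n X"
  let ?N = "space ?F - injections {..<n}"
  have space: "space ?F = extensional {..<n}"
    using sets_eq_imp_space_eq[OF sets_factorial_moment_measure[of M n X]] by (simp add: space_PiM PiE_def)
  show "{x \<in> space ?F. \<not> inj_on x {..<n}} \<subseteq> ?N"
    by (auto simp: injections_def)
  show N [measurable]: "?N \<in> sets ?F"
    using injections_in_sets_PiM[of "{..<n}"] by (intro sets.Diff sets.top) simp
  have injections: "(\<lambda>i\<in>{..<n}. X (js ! i) \<omega>) \<in> injections {..<n}"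
    if "inj (\<lambda>i. X i \<omega>)" "js \<in> distinct_lists n" for js \<omega>
    using that(2)
    by (auto simp: injections_def inj_on_def distinct_lists_def nth_eq_iff_index_eq dest!: injD[OF that(1)])
  have "emeasure ?F ?N = integral\<^sup>N ?F (indicator ?N)"
    using N by simp
  also have "\<dots> = (\<integral>\<^sup>+ \<omega>. \<integral>\<^sup>+ js. indicator ?N (\<lambda>i\<in>{..<n}. X (js ! i) \<omega>) \<partial>count_space (distinct_lists n) \<partial>M)"
    by (rule nn_integral_factorial_moment_measure[OF X]) (use N in simp)
  also have "\<dots> = (\<integral>\<^sup>+ \<omega>. 0 \<partial>M)"
  proof (rule nn_integral_cong_AE, use inj in eventually_elim)
    fix \<omega> assume "inj (\<lambda>i. X i \<omega>)"
    then have "(\<integral>\<^sup>+ js. indicator ?N (\<lambda>i\<in>{..<n}. X (js ! i) \<omega>) \<partial>count_space (distinct_lists n))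
        = (\<integral>\<^sup>+ js. 0 \<partial>count_space (distinct_lists n :: nat list set))"
      by (intro nn_integral_cong) (simp add: injections)
    then show "(\<integral>\<^sup>+ js. indicator ?N (\<lambda>i\<in>{..<n}. X (js ! i) \<omega>) \<partial>count_space (distinct_lists n)) = 0"
      by simp
  qed
  finally show "emeasure ?F ?N = 0" by simp
qed

abbreviation intensity_measure :: "real \<Rightarrow> 'b::euclidean_space measure" where
  "intensity_measure \<rho> \<equiv> density lborel (\<lambda>_. ennreal \<rho>)"

lemma sigma_finite_intensity_measure: "sigma_finite_measure (intensity_measure \<rho>)"
  using sigma_finite_measure.sigma_finite_iff_density_finite[OF sigma_finite_lborel, of "\<lambda>_. ennreal \<rho>"] by simp

lemma sets_PiM_intensity_measure: "sets (PiM I (\<lambda>_. intensity_measure \<rho>)) = sets (PiM I (\<lambda>_. borel))"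
  by (intro sets_PiM_cong) simp_all

lemma emeasure_intensity_measure:
  assumes "\<rho> \<ge> 0" "B \<in> sets borel" "bounded B"
  shows "emeasure (intensity_measure \<rho>) B = ennreal (\<rho> * measure lborel B)"
  using assms emeasure_bounded_finite[OF assms(3)]
  by (simp add: emeasure_density nn_integral_cmult ennreal_mult emeasure_eq_ennreal_measure less_top)

lemma emeasure_intensity_measure_singleton: "emeasure (intensity_measure \<rho>) {z} = 0"
  by (simp add: emeasure_density nn_integral_cmult)

lemma (in prob_space) nn_integral_of_nat_poisson:
  fixes N :: "'a \<Rightarrow> nat"
  assumes [measurable]: "N \<in> measurable M (count_space UNIV)" and "m \<ge> 0"
    and poisson: "\<And>n. prob {\<omega> \<in> space M. N \<omega> = n} = exp (- m) * m ^ n / fact n"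
  shows "(\<integral>\<^sup>+ \<omega>. of_nat (N \<omega>) \<partial>M) = ennreal m"
proof -
  have "(\<integral>\<^sup>+ \<omega>. of_nat (N \<omega>) \<partial>M) = (\<integral>\<^sup>+ n. of_nat n \<partial>distr M (count_space UNIV) N)"
    by (simp add: nn_integral_distr)
  also have "distr M (count_space UNIV) N
      = density (count_space UNIV) (\<lambda>n. ennreal (exp (- m) * m ^ n / fact n))"
  proof (rule measure_eqI_countable[of _ UNIV])
    fix n
    have "N -` {n} \<inter> space M = {\<omega> \<in> space M. N \<omega> = n}"
      by auto
    then show "emeasure (distr M (count_space UNIV) N) {n}
        = emeasure (density (count_space UNIV) (\<lambda>n. ennreal (exp (- m) * m ^ n / fact n))) {n}"
      by (simp add: emeasure_distr emeasure_eq_measure poisson emeasure_density)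
  qed simp_all
  also have "(\<integral>\<^sup>+ n. of_nat n \<partial>density (count_space UNIV) (\<lambda>n. ennreal (exp (- m) * m ^ n / fact n)))
      = (\<Sum>n. ennreal (real n * (exp (- m) * m ^ n / fact n)))"
    using \<open>m \<ge> 0\<close>
    by (simp add: nn_integral_density nn_integral_count_space_nat ennreal_of_nat_eq_real_of_nat
        mult.commute flip: ennreal_mult)
  also have "\<dots> = ennreal m"
  proof (rule suminf_ennreal_eq)
    have "(\<lambda>n. (m * exp (- m)) * (m ^ n /\<^sub>R fact n)) sums ((m * exp (- m)) * exp m)"
      by (intro sums_mult exp_converges)
    also have "(\<lambda>n. (m * exp (- m)) * (m ^ n /\<^sub>R fact n))
       = (\<lambda>n. real (Suc n) * (exp (- m) * m ^ Suc n / fact (Suc n)))"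
      by (auto simp: field_simps simp del: of_nat_Suc)
    also have "(m * exp (- m)) * exp m = m" by (simp add: exp_minus)
    finally show "(\<lambda>n. real n * (exp (- m) * m ^ n / fact n)) sums m"
      by (subst (asm) sums_Suc_iff) simp
  qed (use \<open>m \<ge> 0\<close> in auto)
  finally show ?thesis .
qed

locale poisson_process = prob_space M for M :: "'a measure" +
  fixes \<rho> :: real and X :: "nat \<Rightarrow> 'a \<Rightarrow> real^2"
  assumes intensity_pos: "\<rho> > 0" and poisson_pp: "poisson_pp \<rho> X"
begin

abbreviation \<nu> :: "(real^2) measure" where
  "\<nu> \<equiv> intensity_measure \<rho>"

sublocale \<nu>: sigma_finite_measure \<nu>
  by (rule sigma_finite_intensity_measure)

lemma measurable_points [measurable]: "(\<lambda>\<omega> i. X i \<omega>) \<in> measurable M (PiM UNIV (\<lambda>_. borel))"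
  using poisson_pp by (simp add: poisson_pp_def)

lemma borel_measurable_point [measurable]: "X i \<in> borel_measurable M"
  using measurable_compose[OF measurable_points measurable_component_singleton[of i UNIV]] by simp

lemma AE_inj_points: "AE \<omega> in M. inj (\<lambda>i. X i \<omega>)"
  using poisson_pp by (simp add: poisson_pp_def)

lemma AE_finite_points:
  assumes "B \<in> sets borel" "bounded B"
  shows "AE \<omega> in M. finite {k. X k \<omega> \<in> B}"
  using poisson_pp assms by (simp add: poisson_pp_def)

lemma indep_vars_pp_count:
  fixes J :: "nat set"
  assumes "finite J" "disjoint_family_on B J" "\<And>j. j \<in> J \<Longrightarrow> B j \<in> sets borel" "\<And>j. j \<in> J \<Longrightarrow> bounded (B j)"
  shows "indep_vars (\<lambda>_. count_space UNIV) (\<lambda>j \<omega>. pp_count (\<lambda>i. X i \<omega>) (B j)) J"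
  using poisson_pp assms by (simp add: poisson_pp_def)

lemma nn_integral_pp_count:
  assumes "B \<in> sets borel" "bounded B"
    and "(\<lambda>\<omega>. pp_count (\<lambda>i. X i \<omega>) B) \<in> measurable M (count_space UNIV)"
  shows "(\<integral>\<^sup>+ \<omega>. of_nat (pp_count (\<lambda>i. X i \<omega>) B) \<partial>M) = emeasure \<nu> B"
proof -
  have "(\<integral>\<^sup>+ \<omega>. of_nat (pp_count (\<lambda>i. X i \<omega>) B) \<partial>M) = ennreal (\<rho> * measure lborel B)"
    using poisson_pp assms intensity_pos by (intro nn_integral_of_nat_poisson) (auto simp: poisson_pp_def)
  then show ?thesis
    using assms intensity_pos by (simp add: emeasure_intensity_measure)
qed

lemma nn_integral_prod_ecard_points:
  fixes J :: "nat set"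
  assumes J: "finite J" "disjoint_family_on B J"
    and B: "\<And>j. j \<in> J \<Longrightarrow> B j \<in> sets borel" "\<And>j. j \<in> J \<Longrightarrow> bounded (B j)"
  shows "(\<integral>\<^sup>+ \<omega>. (\<Prod>j\<in>J. ecard {k. X k \<omega> \<in> B j}) \<partial>M) = (\<Prod>j\<in>J. emeasure \<nu> (B j))"
proof -
  let ?N = "\<lambda>j \<omega>. pp_count (\<lambda>i. X i \<omega>) (B j)"
  have indep: "indep_vars (\<lambda>_. count_space UNIV) ?N J"
    by (rule indep_vars_pp_count[OF J B])
  have "AE \<omega> in M. \<forall>j\<in>J. finite {k. X k \<omega> \<in> B j}"
    using J(1) B by (intro AE_finite_allI AE_finite_points)
  then have "AE \<omega> in M. (\<Prod>j\<in>J. ecard {k. X k \<omega> \<in> B j}) = (\<Prod>j\<in>J. of_nat (?N j \<omega>))"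
    by eventually_elim (intro prod.cong refl, simp add: pp_count_def)
  then have "(\<integral>\<^sup>+ \<omega>. (\<Prod>j\<in>J. ecard {k. X k \<omega> \<in> B j}) \<partial>M) = (\<integral>\<^sup>+ \<omega>. (\<Prod>j\<in>J. of_nat (?N j \<omega>)) \<partial>M)"
    by (rule nn_integral_cong_AE)
  also have "\<dots> = (\<Prod>j\<in>J. \<integral>\<^sup>+ \<omega>. of_nat (?N j \<omega>) \<partial>M)"
    by (intro indep_vars_nn_integral indep_vars_compose2[OF indep] J(1)) auto
  also have "\<dots> = (\<Prod>j\<in>J. emeasure \<nu> (B j))"
  proof (intro prod.cong refl)
    fix j assume "j \<in> J"
    then have "?N j \<in> measurable M (count_space UNIV)"
      using indep by (simp add: indep_vars_def)
    then show "(\<integral>\<^sup>+ \<omega>. of_nat (?N j \<omega>) \<partial>M) = emeasure \<nu> (B j)"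
      by (rule nn_integral_pp_count[OF B[OF \<open>j \<in> J\<close>]])
  qed
  finally show ?thesis .
qed

theorem factorial_moment_measure_eq_PiM: "factorial_moment_measure M n X = PiM {..<n} (\<lambda>_. \<nu>)"
proof (rule measure_eqI_disjoint_boxes)
  interpret product_sigma_finite "\<lambda>_::nat. \<nu>" ..
  fix S :: "(nat \<Rightarrow> real^2) set" assume "S \<in> disjoint_boxes {..<n}"
  then obtain B where B: "S = PiE {..<n} B" "\<And>i. i < n \<Longrightarrow> B i \<in> sets borel" "\<And>i. i < n \<Longrightarrow> bounded (B i)"
    "disjoint_family_on B {..<n}"
    by (auto simp: disjoint_boxes_def)
  have box: "emeasure (PiM {..<n} (\<lambda>_. \<nu>)) S = (\<Prod>i<n. emeasure \<nu> (B i))"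
    unfolding B(1) using B(2) by (intro emeasure_PiM) auto
  have "emeasure (factorial_moment_measure M n X) S = (\<integral>\<^sup>+ \<omega>. (\<Prod>i<n. ecard {k. X k \<omega> \<in> B i}) \<partial>M)"
    unfolding B(1) using B by (intro emeasure_factorial_moment_measure_PiE) auto
  also have "\<dots> = (\<Prod>i<n. emeasure \<nu> (B i))"
    using B by (intro nn_integral_prod_ecard_points) auto
  finally show "emeasure (factorial_moment_measure M n X) S = emeasure (PiM {..<n} (\<lambda>_. \<nu>)) S"
    by (simp only: box)
  show "emeasure (PiM {..<n} (\<lambda>_. \<nu>)) S \<noteq> \<infinity>"
    unfolding box using B intensity_pos by (simp add: ennreal_prod_eq_top emeasure_intensity_measure)
next
  show "AE x in factorial_moment_measure M n X. inj_on x {..<n}"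
    by (rule AE_factorial_moment_measure_inj_on[OF borel_measurable_point AE_inj_points])
  show "AE x in PiM {..<n} (\<lambda>_. \<nu>). inj_on x {..<n}"
    by (rule AE_PiM_inj_on[OF sigma_finite_intensity_measure _ emeasure_intensity_measure_singleton]) simp_all
  show "sets (PiM {..<n} (\<lambda>_. \<nu>)) = sets (PiM {..<n} (\<lambda>_. borel))"
    by (rule sets_PiM_intensity_measure)
  show "sets (factorial_moment_measure M n X) = sets (PiM {..<n} (\<lambda>_. borel))"
    by (rule sets_factorial_moment_measure)
qed (rule finite_lessThan)

corollary campbell_formula:
  assumes "(\<lambda>x. f (map x [0..<n])) \<in> borel_measurable (PiM {..<n} (\<lambda>_. borel))"
  shows "(\<integral>\<^sup>+ \<omega>. \<integral>\<^sup>+ js. f (map (\<lambda>j. X j \<omega>) js) \<partial>count_space (distinct_lists n) \<partial>M)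
    = iterated_nn_integral \<nu> n f"
proof -
  have "(\<integral>\<^sup>+ \<omega>. \<integral>\<^sup>+ js. f (map (\<lambda>j. X j \<omega>) js) \<partial>count_space (distinct_lists n) \<partial>M)
      = (\<integral>\<^sup>+ \<omega>. \<integral>\<^sup>+ js. f (map (\<lambda>i\<in>{..<n}. X (js ! i) \<omega>) [0..<n]) \<partial>count_space (distinct_lists n) \<partial>M)"
    by (intro nn_integral_cong arg_cong[where f=f] nth_equalityI) (auto simp: distinct_lists_def)
  also have "\<dots> = (\<integral>\<^sup>+ x. f (map x [0..<n]) \<partial>PiM {..<n} (\<lambda>_. \<nu>))"
    unfolding factorial_moment_measure_eq_PiM[symmetric]
    by (rule nn_integral_factorial_moment_measure[OF borel_measurable_point assms, symmetric])
  also have "\<dots> = iterated_nn_integral \<nu> n f"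
    using assms \<nu>.nn_integral_PiM_eq_iterated_nn_integral[of "[0..<n]" f]
    by (simp add: atLeast0LessThan measurable_cong_sets[OF sets_PiM_intensity_measure refl])
  finally show ?thesis .
qed

end

section \<open>The random connection model\<close>

context prob_space
begin

lemma distr_pair_indep_set:
  assumes [measurable]: "Y \<in> measurable M S" "Z \<in> measurable M T"
    and indep: "indep_set (sigma_sets (space M) {Y -` A \<inter> space M | A. A \<in> sets S})
      (sigma_sets (space M) {Z -` B \<inter> space M | B. B \<in> sets T})"
  shows "distr M (S \<Otimes>\<^sub>M T) (\<lambda>\<omega>. (Y \<omega>, Z \<omega>)) = distr M S Y \<Otimes>\<^sub>M distr M T Z"
proof (rule pair_measure_eqI[symmetric])
  fix A B assume "A \<in> sets (distr M S Y)" "B \<in> sets (distr M T Z)"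
  then have [measurable]: "A \<in> sets S" "B \<in> sets T" by simp_all
  have "prob ((Y -` A \<inter> space M) \<inter> (Z -` B \<inter> space M)) = prob (Y -` A \<inter> space M) * prob (Z -` B \<inter> space M)"
    by (rule indep_setD[OF indep]) (rule sigma_sets.Basic, use \<open>A \<in> sets S\<close> \<open>B \<in> sets T\<close> in blast)+
  moreover have "(\<lambda>\<omega>. (Y \<omega>, Z \<omega>)) -` (A \<times> B) \<inter> space M = (Y -` A \<inter> space M) \<inter> (Z -` B \<inter> space M)"
    by auto
  ultimately show "emeasure (distr M S Y) A * emeasure (distr M T Z) B
      = emeasure (distr M (S \<Otimes>\<^sub>M T) (\<lambda>\<omega>. (Y \<omega>, Z \<omega>))) (A \<times> B)"
    by (simp add: emeasure_distr emeasure_eq_measure flip: ennreal_mult)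
qed (simp_all add: prob_space_distr prob_space_imp_sigma_finite cong: sets_pair_measure_cong)

lemma nn_integral_indep_set:
  assumes [measurable]: "Y \<in> measurable M S" "Z \<in> measurable M T" "f \<in> borel_measurable (S \<Otimes>\<^sub>M T)"
    and indep: "indep_set (sigma_sets (space M) {Y -` A \<inter> space M | A. A \<in> sets S})
      (sigma_sets (space M) {Z -` B \<inter> space M | B. B \<in> sets T})"
  shows "(\<integral>\<^sup>+ \<omega>. f (Y \<omega>, Z \<omega>) \<partial>M) = (\<integral>\<^sup>+ \<omega>. \<integral>\<^sup>+ \<omega>'. f (Y \<omega>, Z \<omega>') \<partial>M \<partial>M)"
proof -
  interpret Z: prob_space "distr M T Z" by (rule prob_space_distr) simp
  have "(\<integral>\<^sup>+ \<omega>. f (Y \<omega>, Z \<omega>) \<partial>M) = integral\<^sup>N (distr M (S \<Otimes>\<^sub>M T) (\<lambda>\<omega>. (Y \<omega>, Z \<omega>))) f"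
    by (simp add: nn_integral_distr)
  also have "\<dots> = (\<integral>\<^sup>+ s. \<integral>\<^sup>+ t. f (s, t) \<partial>distr M T Z \<partial>distr M S Y)"
    by (simp add: distr_pair_indep_set[OF _ _ indep] Z.nn_integral_fst)
  also have "\<dots> = (\<integral>\<^sup>+ \<omega>. \<integral>\<^sup>+ t. f (Y \<omega>, t) \<partial>distr M T Z \<partial>M)"
    by (intro nn_integral_distr Z.borel_measurable_nn_integral_fst) simp_all
  also have "\<dots> = (\<integral>\<^sup>+ \<omega>. \<integral>\<^sup>+ \<omega>'. f (Y \<omega>, Z \<omega>') \<partial>M \<partial>M)"
  proof (rule nn_integral_cong)
    fix \<omega> assume "\<omega> \<in> space M"
    then have "Y \<omega> \<in> space S"
      by (rule measurable_space[OF assms(1)])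
    then have "(\<lambda>t. f (Y \<omega>, t)) \<in> borel_measurable T"
      by measurable
    then show "(\<integral>\<^sup>+ t. f (Y \<omega>, t) \<partial>distr M T Z) = (\<integral>\<^sup>+ \<omega>'. f (Y \<omega>, Z \<omega>') \<partial>M)"
      by (intro nn_integral_distr) simp_all
  qed
  finally show ?thesis .
qed

lemma emeasure_uniform_less:
  assumes "distributed M lborel V (indicator {0..1})" and "0 \<le> c" "c \<le> 1"
  shows "emeasure M {\<omega> \<in> space M. V \<omega> < c} = ennreal c"
proof -
  have V: "V -` {..<c} \<inter> space M = {\<omega> \<in> space M. V \<omega> < c}"
    by auto
  have "emeasure M {\<omega> \<in> space M. V \<omega> < c} = (\<integral>\<^sup>+ t. indicator {0..1} t * indicator {..<c} t \<partial>lborel)"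
    using distributed_emeasure[OF assms(1), of "{..<c}"] by (simp add: V)
  also have "\<dots> = (\<integral>\<^sup>+ t. indicator {0..<c} t \<partial>lborel)"
    using assms(3) by (intro nn_integral_cong) (auto split: split_indicator)
  finally show ?thesis using assms(2) by simp
qed

lemma emeasure_indep_uniform_less:
  assumes indep: "indep_vars (\<lambda>_. borel) V K" and "finite K"
    and uniform: "\<And>k. k \<in> K \<Longrightarrow> distributed M lborel (V k) (indicator {0..1})"
    and c: "\<And>k. k \<in> K \<Longrightarrow> 0 \<le> c k" "\<And>k. k \<in> K \<Longrightarrow> c k \<le> 1"
  shows "emeasure M {\<omega> \<in> space M. \<forall>k\<in>K. V k \<omega> < c k} = (\<Prod>k\<in>K. ennreal (c k))"
proof (cases "K = {}")
  case False
  have V: "V k -` {..<c k} \<inter> space M = {\<omega> \<in> space M. V k \<omega> < c k}" for k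
    by auto
  have "{\<omega> \<in> space M. \<forall>k\<in>K. V k \<omega> < c k} = (\<Inter>k\<in>K. V k -` {..<c k} \<inter> space M)"
    using False by auto
  then have "emeasure M {\<omega> \<in> space M. \<forall>k\<in>K. V k \<omega> < c k} = (\<Prod>k\<in>K. emeasure M {\<omega> \<in> space M. V k \<omega> < c k})"
    using indep_varsD[OF indep False \<open>finite K\<close> subset_refl, of "\<lambda>k. {..<c k}"]
    by (simp add: emeasure_eq_measure prod_ennreal V)
  then show ?thesis
    using uniform c by (simp add: emeasure_uniform_less)
qed (simp add: emeasure_space_1)

end

locale random_connection_model = poisson_process M \<rho> X
  for M :: "'a measure" and \<rho> :: real and X :: "nat \<Rightarrow> 'a \<Rightarrow> real^2" +
  fixes U :: "mark_idx \<Rightarrow> 'a \<Rightarrow> real" and h :: "real \<Rightarrow> real" and x y :: "real^2"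
  assumes rcm_marks: "rcm_marks X U"
    and borel_measurable_h [measurable]: "h \<in> borel_measurable borel"
    and h_nonneg: "0 \<le> h r" and h_le_1: "h r \<le> 1"
begin

definition conn_prob :: "(nat \<Rightarrow> real^2) \<Rightarrow> mark_idx \<Rightarrow> real" where
  "conn_prob Z k = (case k of
      Ux i \<Rightarrow> h (norm (x - Z i))
    | Ue i j \<Rightarrow> h (norm (Z i - Z j))
    | Uy j \<Rightarrow> h (norm (Z j - y)))"

lemma borel_measurable_conn_prob [measurable]: "(\<lambda>Z. conn_prob Z k) \<in> borel_measurable (PiM UNIV (\<lambda>_. borel))"
  by (cases k) (simp_all add: conn_prob_def)

lemma conn_prob_nonneg: "0 \<le> conn_prob Z k" and conn_prob_le_1: "conn_prob Z k \<le> 1"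
  by (simp_all add: conn_prob_def h_nonneg h_le_1 split: mark_idx.split)

lemma borel_measurable_mark [measurable]: "U k \<in> borel_measurable M"
  using rcm_marks by (simp add: rcm_marks_def indep_vars_def)

definition all_open :: "mark_idx set \<Rightarrow> 'a \<Rightarrow> bool" where
  "all_open K \<omega> \<longleftrightarrow> (\<forall>k\<in>K. U k \<omega> < conn_prob (\<lambda>i. X i \<omega>) k)"

lemma all_open_Un: "all_open (K \<union> L) \<omega> \<longleftrightarrow> all_open K \<omega> \<and> all_open L \<omega>"
  by (auto simp: all_open_def)

lemma measurable_all_open [measurable]: "finite K \<Longrightarrow> Measurable.pred M (all_open K)"
  unfolding all_open_def[abs_def] by measurable

lemma emeasure_all_open:
  assumes K: "finite K"
  shows "emeasure M {\<omega> \<in> space M. all_open K \<omega>} = (\<integral>\<^sup>+ \<omega>. (\<Prod>k\<in>K. ennreal (conn_prob (\<lambda>i. X i \<omega>) k)) \<partial>M)"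
proof -
  let ?f = "\<lambda>(Z, u). of_bool (\<forall>k\<in>K. u k < conn_prob Z k) :: ennreal"
  have U: "(\<lambda>\<omega> k. U k \<omega>) \<in> measurable M (PiM UNIV (\<lambda>_. borel))"
    and indep: "indep_set
      (sigma_sets (space M) {(\<lambda>\<omega> i. X i \<omega>) -` A \<inter> space M | A. A \<in> sets (PiM UNIV (\<lambda>_. borel))})
      (sigma_sets (space M) {(\<lambda>\<omega> k. U k \<omega>) -` A \<inter> space M | A. A \<in> sets (PiM UNIV (\<lambda>_. borel))})"
    and iid: "indep_vars (\<lambda>_. borel) U K" "\<And>k. distributed M lborel (U k) (indicator {0..1})"
    using rcm_marks by (auto simp: rcm_marks_def intro: indep_vars_subset)
  have [measurable]: "?f \<in> borel_measurable (PiM UNIV (\<lambda>_. borel) \<Otimes>\<^sub>M PiM UNIV (\<lambda>_. borel))"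
    using K by measurable
  have "emeasure M {\<omega> \<in> space M. all_open K \<omega>} = (\<integral>\<^sup>+ \<omega>. ?f (\<lambda>i. X i \<omega>, \<lambda>k. U k \<omega>) \<partial>M)"
    using K by (simp add: emeasure_Collect_eq_nn_integral all_open_def)
  also have "\<dots> = (\<integral>\<^sup>+ \<omega>. \<integral>\<^sup>+ \<omega>'. ?f (\<lambda>i. X i \<omega>, \<lambda>k. U k \<omega>') \<partial>M \<partial>M)"
    by (rule nn_integral_indep_set[OF measurable_points U _ indep]) simp
  also have "\<dots> = (\<integral>\<^sup>+ \<omega>. emeasure M {\<omega>' \<in> space M. \<forall>k\<in>K. U k \<omega>' < conn_prob (\<lambda>i. X i \<omega>) k} \<partial>M)"
    using K by (simp add: emeasure_Collect_eq_nn_integral)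
  also have "\<dots> = (\<integral>\<^sup>+ \<omega>. (\<Prod>k\<in>K. ennreal (conn_prob (\<lambda>i. X i \<omega>) k)) \<partial>M)"
    using K iid by (simp add: emeasure_indep_uniform_less conn_prob_nonneg conn_prob_le_1)
  finally show ?thesis .
qed

lemma borel_measurable_ecard_all_open:
  fixes K :: "nat list \<Rightarrow> mark_idx set"
  assumes K: "\<And>js. js \<in> distinct_lists n \<Longrightarrow> finite (K js)"
  shows "(\<lambda>\<omega>. ecard {js \<in> distinct_lists n. all_open (K js) \<omega>}) \<in> borel_measurable M"
proof -
  interpret J: sigma_finite_measure "count_space (distinct_lists n :: nat list set)"
    by (rule sigma_finite_measure_count_space_countable[OF countableI_type])
  have "(\<lambda>(js, \<omega>). of_bool (all_open (K js) \<omega>) :: ennreal)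
      \<in> borel_measurable (count_space (distinct_lists n) \<Otimes>\<^sub>M M)"
    using K by (intro measurable_pair_measure_countable1) (simp_all)
  from measurable_compose[OF measurable_pair_swap' this]
  show ?thesis
    unfolding ecard_Collect_eq_nn_integral
    by (intro J.borel_measurable_nn_integral) (simp add: split_beta')
qed

theorem nn_integral_ecard_all_open:
  assumes K: "\<And>js. js \<in> distinct_lists n \<Longrightarrow> finite (K js)"
    and weight: "\<And>Z js. js \<in> distinct_lists n \<Longrightarrow> (\<Prod>k\<in>K js. ennreal (conn_prob Z k)) = f (map Z js)"
    and f: "(\<lambda>z. f (map z [0..<n])) \<in> borel_measurable (PiM {..<n} (\<lambda>_. borel))"
  shows "(\<integral>\<^sup>+ \<omega>. ecard {js \<in> distinct_lists n. all_open (K js) \<omega>} \<partial>M) = iterated_nn_integral \<nu> n f"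
proof -
  let ?J = "count_space (distinct_lists n :: nat list set)"
  have conn_prob_X: "(\<lambda>\<omega>. conn_prob (\<lambda>i. X i \<omega>) k) \<in> borel_measurable M" for k
    by (rule measurable_compose[OF measurable_points borel_measurable_conn_prob])
  have "(\<integral>\<^sup>+ \<omega>. ecard {js \<in> distinct_lists n. all_open (K js) \<omega>} \<partial>M)
      = (\<integral>\<^sup>+ js. \<integral>\<^sup>+ \<omega>. of_bool (all_open (K js) \<omega>) \<partial>M \<partial>?J)"
    unfolding ecard_Collect_eq_nn_integral using K
    by (intro nn_integral_count_space_nn_integral countableI_type) simp
  also have "\<dots> = (\<integral>\<^sup>+ js. \<integral>\<^sup>+ \<omega>. (\<Prod>k\<in>K js. ennreal (conn_prob (\<lambda>i. X i \<omega>) k)) \<partial>M \<partial>?J)"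
    using K by (intro nn_integral_cong[of ?J]) (simp add: emeasure_all_open flip: emeasure_Collect_eq_nn_integral)
  also have "\<dots> = (\<integral>\<^sup>+ \<omega>. \<integral>\<^sup>+ js. (\<Prod>k\<in>K js. ennreal (conn_prob (\<lambda>i. X i \<omega>) k)) \<partial>?J \<partial>M)"
    using conn_prob_X
    by (intro nn_integral_count_space_nn_integral[symmetric] countableI_type borel_measurable_prod_ennreal)
      simp
  also have "\<dots> = (\<integral>\<^sup>+ \<omega>. \<integral>\<^sup>+ js. f (map (\<lambda>i. X i \<omega>) js) \<partial>?J \<partial>M)"
    by (intro nn_integral_cong) (simp add: weight)
  also have "\<dots> = iterated_nn_integral \<nu> n f"
    by (rule campbell_formula[OF f])
  finally show ?thesis .
qed

end

section \<open>Overlaps of pairs\<close>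

text \<open>
  The entries of the list are the distinct vertices of two pairs, and the indices tell which of them coincide.
\<close>

definition overlap :: "nat \<Rightarrow> nat \<Rightarrow> nat \<Rightarrow> nat \<Rightarrow> 'a list \<Rightarrow> ('a \<times> 'a) \<times> ('a \<times> 'a)" where
  "overlap a b c d js = ((js ! a, js ! b), (js ! c, js ! d))"

lemma ecard_overlap:
  assumes "{a, b, c, d} = {..<n}"
  shows "ecard {js \<in> distinct_lists n. overlap a b c d js \<in> R} = ecard (R \<inter> overlap a b c d ` distinct_lists n)"
proof -
  have "inj_on (overlap a b c d) (distinct_lists n)"
  proof (rule inj_onI)
    fix js ks
    assume "js \<in> distinct_lists n" "ks \<in> distinct_lists n" and eq: "overlap a b c d js = overlap a b c d ks"
    moreover have "js ! i = ks ! i" if "i < n" for i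
    proof -
      have "i \<in> {a, b, c, d}" using that assms by simp
      then show ?thesis using eq by (auto simp: overlap_def)
    qed
    ultimately show "js = ks"
      by (auto simp: distinct_lists_def intro: nth_equalityI)
  qed
  from ecard_Collect_image[OF this, of "\<lambda>r. r \<in> R"] show ?thesis
    by (simp only: Int_def conj_commute)
qed

lemma image_overlap:
  "overlap 0 1 0 1 ` distinct_lists 2 = {((i, j), (k, l)). i \<noteq> j \<and> k = i \<and> l = j}"
  "overlap 0 1 1 0 ` distinct_lists 2 = {((i, j), (k, l)). i \<noteq> j \<and> k = j \<and> l = i}"
  "overlap 0 1 0 2 ` distinct_lists 3 = {((i, j), (k, l)). i \<noteq> j \<and> k = i \<and> l \<notin> {i, j}}"
  "overlap 1 0 0 2 ` distinct_lists 3 = {((i, j), (k, l)). i \<noteq> j \<and> k = j \<and> l \<notin> {i, j}}"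
  "overlap 0 1 2 0 ` distinct_lists 3 = {((i, j), (k, l)). i \<noteq> j \<and> l = i \<and> k \<notin> {i, j}}"
  "overlap 1 0 2 0 ` distinct_lists 3 = {((i, j), (k, l)). i \<noteq> j \<and> l = j \<and> k \<notin> {i, j}}"
  "overlap 0 1 2 3 ` distinct_lists 4 = {((i, j), (k, l)). i \<noteq> j \<and> k \<noteq> l \<and> k \<notin> {i, j} \<and> l \<notin> {i, j}}"
  unfolding image_distinct_lists_2 image_distinct_lists_3 image_distinct_lists_4 overlap_def by auto

lemma ecard_eq_sum_overlaps:
  assumes "R \<subseteq> {((i, j), (k, l)). i \<noteq> j \<and> k \<noteq> l}"
  shows "ecard R
    = ecard {js \<in> distinct_lists 2. overlap 0 1 0 1 js \<in> R}
    + ecard {js \<in> distinct_lists 2. overlap 0 1 1 0 js \<in> R}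
    + ecard {js \<in> distinct_lists 3. overlap 0 1 0 2 js \<in> R}
    + ecard {js \<in> distinct_lists 3. overlap 1 0 0 2 js \<in> R}
    + ecard {js \<in> distinct_lists 3. overlap 0 1 2 0 js \<in> R}
    + ecard {js \<in> distinct_lists 3. overlap 1 0 2 0 js \<in> R}
    + ecard {js \<in> distinct_lists 4. overlap 0 1 2 3 js \<in> R}" (is "_ = ?sum")
proof -
  let ?image = "\<lambda>a b c d n. overlap a b c d ` distinct_lists n"
  have "{((i, j), (k, l)). i \<noteq> j \<and> k \<noteq> l} \<subseteq> ?image 0 1 0 1 2 \<union> ?image 0 1 1 0 2 \<union> ?image 0 1 0 2 3
      \<union> ?image 1 0 0 2 3 \<union> ?image 0 1 2 0 3 \<union> ?image 1 0 2 0 3 \<union> ?image 0 1 2 3 4"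
    unfolding image_overlap by auto
  with assms have "R \<subseteq> ?image 0 1 0 1 2 \<union> ?image 0 1 1 0 2 \<union> ?image 0 1 0 2 3
      \<union> ?image 1 0 0 2 3 \<union> ?image 0 1 2 0 3 \<union> ?image 1 0 2 0 3 \<union> ?image 0 1 2 3 4"
    by (rule subset_trans)
  then have "ecard R = ecard (R \<inter> ?image 0 1 0 1 2 \<union> R \<inter> ?image 0 1 1 0 2 \<union> R \<inter> ?image 0 1 0 2 3
      \<union> R \<inter> ?image 1 0 0 2 3 \<union> R \<inter> ?image 0 1 2 0 3 \<union> R \<inter> ?image 1 0 2 0 3 \<union> R \<inter> ?image 0 1 2 3 4)"
    by (simp only: Int_absorb2 flip: Int_Un_distrib)
  also have "\<dots> = ecard (R \<inter> ?image 0 1 0 1 2) + ecard (R \<inter> ?image 0 1 1 0 2) + ecard (R \<inter> ?image 0 1 0 2 3)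
      + ecard (R \<inter> ?image 1 0 0 2 3) + ecard (R \<inter> ?image 0 1 2 0 3) + ecard (R \<inter> ?image 1 0 2 0 3)
      + ecard (R \<inter> ?image 0 1 2 3 4)"
    unfolding image_overlap by ((subst ecard_Un_disjoint, blast)+, rule refl)
  also have "\<dots> = ?sum"
    by ((subst ecard_overlap, force)+, rule refl)
  finally show ?thesis .
qed

section \<open>Moments of the number of three-hop paths\<close>

definition edge_mark :: "nat \<Rightarrow> nat \<Rightarrow> mark_idx" where
  "edge_mark i j = Ue (min i j) (max i j)"

lemma edge_mark_eq_iff: "edge_mark i j = edge_mark k l \<longleftrightarrow> i = k \<and> j = l \<or> i = l \<and> j = k"
  by (auto simp: edge_mark_def min_def max_def)

lemma edge_mark_neq [simp]:
  "edge_mark i j \<noteq> Ux k" "edge_mark i j \<noteq> Uy k" "Ux k \<noteq> edge_mark i j" "Uy k \<noteq> edge_mark i j"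
  by (simp_all add: edge_mark_def)

definition path_marks :: "nat \<times> nat \<Rightarrow> mark_idx set" where
  "path_marks = (\<lambda>(i, j). {Ux i, edge_mark i j, Uy j})"

definition path_pair_marks :: "(nat \<times> nat) \<times> (nat \<times> nat) \<Rightarrow> mark_idx set" where
  "path_pair_marks = (\<lambda>(p, q). path_marks p \<union> path_marks q)"

lemma finite_path_marks [simp]: "finite (path_marks p)"
  by (simp add: path_marks_def split: prod.split)

lemma finite_path_pair_marks [simp]: "finite (path_pair_marks r)"
  by (simp add: path_pair_marks_def split: prod.split)

context random_connection_model
begin

abbreviation H :: "real^2 \<Rightarrow> real^2 \<Rightarrow> ennreal" where
  "H p q \<equiv> ennreal (h (norm (p - q)))"

lemma H_commute: "H p q = H q p"
  by (simp add: norm_minus_commute)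

lemma ennreal_conn_prob [simp]:
  "ennreal (conn_prob Z (Ux i)) = H x (Z i)" "ennreal (conn_prob Z (edge_mark i j)) = H (Z i) (Z j)"
  "ennreal (conn_prob Z (Uy j)) = H (Z j) y"
  by (simp_all add: conn_prob_def edge_mark_def min_def max_def norm_minus_commute)

definition paths :: "'a \<Rightarrow> (nat \<times> nat) set" where
  "paths \<omega> = {(i, j). i \<noteq> j \<and> all_open (path_marks (i, j)) \<omega>}"

lemma ecard_paths: "ecard (paths \<omega>) = ecard {js \<in> distinct_lists 2. all_open (path_marks (js ! 0, js ! 1)) \<omega>}"
proof -
  let ?pair = "\<lambda>js :: nat list. (js ! 0, js ! 1)"
  have "paths \<omega> = {p \<in> ?pair ` distinct_lists 2. all_open (path_marks p) \<omega>}"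
    unfolding image_distinct_lists_2 by (auto simp: paths_def)
  moreover have "inj_on ?pair (distinct_lists 2)"
    by (auto simp: inj_on_def distinct_lists_def numeral_eq_Suc length_Suc_conv)
  ultimately show ?thesis
    using ecard_Collect_image[of ?pair "distinct_lists 2" "\<lambda>p. all_open (path_marks p) \<omega>"] by simp
qed

lemma borel_measurable_ecard_paths [measurable]: "(\<lambda>\<omega>. ecard (paths \<omega>)) \<in> borel_measurable M"
  unfolding ecard_paths by (rule borel_measurable_ecard_all_open) simp

definition num_overlaps :: "nat \<Rightarrow> nat \<Rightarrow> nat \<Rightarrow> nat \<Rightarrow> nat \<Rightarrow> 'a \<Rightarrow> ennreal" where
  "num_overlaps a b c d n \<omega> = ecard {js \<in> distinct_lists n. all_open (path_pair_marks (overlap a b c d js)) \<omega>}"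

lemma borel_measurable_num_overlaps [measurable]: "num_overlaps a b c d n \<in> borel_measurable M"
  unfolding num_overlaps_def[abs_def] by (rule borel_measurable_ecard_all_open) simp

lemma ecard_paths_square:
  "(ecard (paths \<omega>))\<^sup>2
    = num_overlaps 0 1 0 1 2 \<omega> + num_overlaps 0 1 1 0 2 \<omega> + num_overlaps 0 1 0 2 3 \<omega> + num_overlaps 1 0 0 2 3 \<omega>
    + num_overlaps 0 1 2 0 3 \<omega> + num_overlaps 1 0 2 0 3 \<omega> + num_overlaps 0 1 2 3 4 \<omega>"
proof -
  have mem: "{js \<in> distinct_lists n. overlap a b c d js \<in> paths \<omega> \<times> paths \<omega>}
      = {js \<in> distinct_lists n. all_open (path_pair_marks (overlap a b c d js)) \<omega>}"
    if "a < n" "b < n" "c < n" "d < n" "a \<noteq> b" "c \<noteq> d" for a b c d n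
    using that
    by (auto simp: distinct_lists_def overlap_def paths_def path_pair_marks_def all_open_Un nth_eq_iff_index_eq)
  have "(ecard (paths \<omega>))\<^sup>2 = ecard (paths \<omega> \<times> paths \<omega>)"
    by (simp add: ecard_Times power2_eq_square)
  also have "paths \<omega> \<times> paths \<omega> \<subseteq> {((i, j), (k, l)). i \<noteq> j \<and> k \<noteq> l}"
    by (auto simp: paths_def)
  note ecard_eq_sum_overlaps[OF this]
  finally show ?thesis
    by (simp add: mem num_overlaps_def)
qed

definition two_hop :: "real^2 \<Rightarrow> real^2 \<Rightarrow> ennreal" where
  "two_hop p q = (\<integral>\<^sup>+ z. H p z * H z q \<partial>\<nu>)"

lemma borel_measurable_two_hop [measurable]:
  "(\<lambda>p. two_hop p q) \<in> borel_measurable borel" "(\<lambda>q. two_hop p q) \<in> borel_measurable borel"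
  unfolding two_hop_def by (intro \<nu>.borel_measurable_nn_integral; measurable)+

lemmas path_weight_simps = distinct_lists_def numeral_eq_Suc length_Suc_conv overlap_def
  path_marks_def path_pair_marks_def Un_insert_left prod.insert_if edge_mark_eq_iff

theorem nn_integral_ecard_paths: "(\<integral>\<^sup>+ \<omega>. ecard (paths \<omega>) \<partial>M) = (\<integral>\<^sup>+ a. H x a * two_hop a y \<partial>\<nu>)"
proof -
  have "(\<integral>\<^sup>+ \<omega>. ecard (paths \<omega>) \<partial>M)
      = iterated_nn_integral \<nu> 2 (\<lambda>zs. H x (zs ! 0) * (H (zs ! 0) (zs ! 1) * H (zs ! 1) y))"
    unfolding ecard_paths by (rule nn_integral_ecard_all_open) (auto simp: path_weight_simps)
  also have "\<dots> = (\<integral>\<^sup>+ a. H x a * two_hop a y \<partial>\<nu>)"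
    by (simp add: numeral_eq_Suc nn_integral_cmult two_hop_def)
  finally show ?thesis .
qed

lemma nn_integral_num_overlaps_equal:
  "(\<integral>\<^sup>+ \<omega>. num_overlaps 0 1 0 1 2 \<omega> \<partial>M) = (\<integral>\<^sup>+ a. H x a * two_hop a y \<partial>\<nu>)"
  by (simp add: ecard_paths num_overlaps_def path_pair_marks_def overlap_def flip: nn_integral_ecard_paths)

lemma nn_integral_num_overlaps_reversed:
  "(\<integral>\<^sup>+ \<omega>. num_overlaps 0 1 1 0 2 \<omega> \<partial>M) = (\<integral>\<^sup>+ a. H x a * H a y * (\<integral>\<^sup>+ b. H x b * H b y * H b a \<partial>\<nu>) \<partial>\<nu>)"
proof -
  have "(\<integral>\<^sup>+ \<omega>. num_overlaps 0 1 1 0 2 \<omega> \<partial>M)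
      = iterated_nn_integral \<nu> 2 (\<lambda>zs. H x (zs ! 0) * H (zs ! 0) y
        * (H x (zs ! 1) * H (zs ! 1) y * H (zs ! 1) (zs ! 0)))"
    unfolding num_overlaps_def by (rule nn_integral_ecard_all_open) (auto simp: path_weight_simps ac_simps)
  also have "\<dots> = (\<integral>\<^sup>+ a. H x a * H a y * (\<integral>\<^sup>+ b. H x b * H b y * H b a \<partial>\<nu>) \<partial>\<nu>)"
    by (simp add: numeral_eq_Suc nn_integral_cmult)
  finally show ?thesis .
qed

lemma nn_integral_num_overlaps_common_first:
  "(\<integral>\<^sup>+ \<omega>. num_overlaps 0 1 0 2 3 \<omega> \<partial>M) = (\<integral>\<^sup>+ a. H x a * (two_hop a y)\<^sup>2 \<partial>\<nu>)"
proof -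
  have "(\<integral>\<^sup>+ \<omega>. num_overlaps 0 1 0 2 3 \<omega> \<partial>M)
      = iterated_nn_integral \<nu> 3 (\<lambda>zs. H x (zs ! 0)
        * (H (zs ! 0) (zs ! 1) * H (zs ! 1) y * (H (zs ! 0) (zs ! 2) * H (zs ! 2) y)))"
    unfolding num_overlaps_def by (rule nn_integral_ecard_all_open) (auto simp: path_weight_simps ac_simps)
  also have "\<dots> = (\<integral>\<^sup>+ a. H x a * (two_hop a y)\<^sup>2 \<partial>\<nu>)"
    by (simp add: numeral_eq_Suc nn_integral_cmult nn_integral_multc power2_eq_square flip: two_hop_def)
  finally show ?thesis .
qed

lemma nn_integral_num_overlaps_common_last:
  "(\<integral>\<^sup>+ \<omega>. num_overlaps 1 0 2 0 3 \<omega> \<partial>M) = (\<integral>\<^sup>+ a. H a y * (two_hop x a)\<^sup>2 \<partial>\<nu>)"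
proof -
  have "(\<integral>\<^sup>+ \<omega>. num_overlaps 1 0 2 0 3 \<omega> \<partial>M)
      = iterated_nn_integral \<nu> 3 (\<lambda>zs. H (zs ! 0) y
        * (H x (zs ! 1) * H (zs ! 1) (zs ! 0) * (H x (zs ! 2) * H (zs ! 2) (zs ! 0))))"
    unfolding num_overlaps_def by (rule nn_integral_ecard_all_open) (auto simp: path_weight_simps ac_simps)
  also have "\<dots> = (\<integral>\<^sup>+ a. H a y * (two_hop x a)\<^sup>2 \<partial>\<nu>)"
    by (simp add: numeral_eq_Suc nn_integral_cmult nn_integral_multc power2_eq_square flip: two_hop_def)
  finally show ?thesis .
qed

lemma nn_integral_num_overlaps_first_is_last:
  "(\<integral>\<^sup>+ \<omega>. num_overlaps 0 1 2 0 3 \<omega> \<partial>M) = (\<integral>\<^sup>+ a. H x a * H a y * (two_hop x a * two_hop a y) \<partial>\<nu>)"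
proof -
  have "(\<integral>\<^sup>+ \<omega>. num_overlaps 0 1 2 0 3 \<omega> \<partial>M)
      = iterated_nn_integral \<nu> 3 (\<lambda>zs. H x (zs ! 0) * H (zs ! 0) y
        * (H x (zs ! 2) * H (zs ! 2) (zs ! 0) * (H (zs ! 0) (zs ! 1) * H (zs ! 1) y)))"
    unfolding num_overlaps_def by (rule nn_integral_ecard_all_open) (auto simp: path_weight_simps ac_simps)
  also have "\<dots> = (\<integral>\<^sup>+ a. H x a * H a y * (two_hop x a * two_hop a y) \<partial>\<nu>)"
    by (simp add: numeral_eq_Suc nn_integral_cmult nn_integral_multc flip: two_hop_def)
  finally show ?thesis .
qed

lemma nn_integral_num_overlaps_last_is_first:
  "(\<integral>\<^sup>+ \<omega>. num_overlaps 1 0 0 2 3 \<omega> \<partial>M) = (\<integral>\<^sup>+ a. H x a * H a y * (two_hop x a * two_hop a y) \<partial>\<nu>)"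
proof -
  have "(\<integral>\<^sup>+ \<omega>. num_overlaps 1 0 0 2 3 \<omega> \<partial>M)
      = iterated_nn_integral \<nu> 3 (\<lambda>zs. H x (zs ! 0) * H (zs ! 0) y
        * (H x (zs ! 1) * H (zs ! 1) (zs ! 0) * (H (zs ! 0) (zs ! 2) * H (zs ! 2) y)))"
    unfolding num_overlaps_def by (rule nn_integral_ecard_all_open) (auto simp: path_weight_simps ac_simps)
  also have "\<dots> = (\<integral>\<^sup>+ a. H x a * H a y * (two_hop x a * two_hop a y) \<partial>\<nu>)"
    by (simp add: numeral_eq_Suc nn_integral_cmult nn_integral_multc flip: two_hop_def)
  finally show ?thesis .
qed

lemma nn_integral_num_overlaps_disjoint:
  "(\<integral>\<^sup>+ \<omega>. num_overlaps 0 1 2 3 4 \<omega> \<partial>M) = (\<integral>\<^sup>+ a. H x a * two_hop a y \<partial>\<nu>)\<^sup>2"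
proof -
  have "(\<integral>\<^sup>+ \<omega>. num_overlaps 0 1 2 3 4 \<omega> \<partial>M)
      = iterated_nn_integral \<nu> 4 (\<lambda>zs. (H x (zs ! 0) * (H (zs ! 0) (zs ! 1) * H (zs ! 1) y))
        * (H x (zs ! 2) * (H (zs ! 2) (zs ! 3) * H (zs ! 3) y)))"
    unfolding num_overlaps_def by (rule nn_integral_ecard_all_open) (auto simp: path_weight_simps ac_simps)
  also have "\<dots> = (\<integral>\<^sup>+ a. H x a * two_hop a y \<partial>\<nu>)\<^sup>2"
    by (simp add: numeral_eq_Suc nn_integral_cmult nn_integral_multc power2_eq_square flip: two_hop_def)
  finally show ?thesis .
qed

theorem nn_integral_ecard_paths_square:
  "(\<integral>\<^sup>+ \<omega>. (ecard (paths \<omega>))\<^sup>2 \<partial>M)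
    = (\<integral>\<^sup>+ a. H x a * two_hop a y \<partial>\<nu>)
    + (\<integral>\<^sup>+ a. H x a * H a y * (\<integral>\<^sup>+ b. H x b * H b y * H b a \<partial>\<nu>) \<partial>\<nu>)
    + (\<integral>\<^sup>+ a. H x a * (two_hop a y)\<^sup>2 \<partial>\<nu>)
    + (\<integral>\<^sup>+ a. H a y * (two_hop x a)\<^sup>2 \<partial>\<nu>)
    + 2 * (\<integral>\<^sup>+ a. H x a * H a y * (two_hop x a * two_hop a y) \<partial>\<nu>)
    + (\<integral>\<^sup>+ a. H x a * two_hop a y \<partial>\<nu>)\<^sup>2"
proof -
  have "(\<integral>\<^sup>+ \<omega>. (ecard (paths \<omega>))\<^sup>2 \<partial>M)
      = (\<integral>\<^sup>+ \<omega>. num_overlaps 0 1 0 1 2 \<omega> \<partial>M) + (\<integral>\<^sup>+ \<omega>. num_overlaps 0 1 1 0 2 \<omega> \<partial>M)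
      + (\<integral>\<^sup>+ \<omega>. num_overlaps 0 1 0 2 3 \<omega> \<partial>M) + (\<integral>\<^sup>+ \<omega>. num_overlaps 1 0 0 2 3 \<omega> \<partial>M)
      + (\<integral>\<^sup>+ \<omega>. num_overlaps 0 1 2 0 3 \<omega> \<partial>M) + (\<integral>\<^sup>+ \<omega>. num_overlaps 1 0 2 0 3 \<omega> \<partial>M)
      + (\<integral>\<^sup>+ \<omega>. num_overlaps 0 1 2 3 4 \<omega> \<partial>M)"
    by (simp add: ecard_paths_square nn_integral_add)
  then show ?thesis
    unfolding nn_integral_num_overlaps_equal nn_integral_num_overlaps_reversed
      nn_integral_num_overlaps_common_first nn_integral_num_overlaps_common_last
      nn_integral_num_overlaps_first_is_last nn_integral_num_overlaps_last_is_first
      nn_integral_num_overlaps_disjoint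
    by (simp add: mult_2 add_ac)
qed

end

section \<open>Gaussian integrals\<close>

definition gaussian :: "real \<Rightarrow> real \<Rightarrow> 'b::real_inner \<Rightarrow> 'b \<Rightarrow> ennreal" where
  "gaussian c s p q = ennreal (c * exp (- s * (norm (p - q))\<^sup>2))"

lemma borel_measurable_gaussian [measurable]:
  fixes p q :: "'b::euclidean_space"
  shows "gaussian c s p \<in> borel_measurable borel" "(\<lambda>p. gaussian c s p q) \<in> borel_measurable borel"
  unfolding gaussian_def by measurable

lemma gaussian_commute: "gaussian c s p q = gaussian c s q p"
  by (simp add: gaussian_def norm_minus_commute)

lemma gaussian_mult:
  assumes "c \<ge> 0" "d \<ge> 0"
  shows "gaussian c s p q * gaussian d t p q = gaussian (c * d) (s + t) p q"
  using assms by (simp add: gaussian_def algebra_simps flip: ennreal_mult exp_add)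

lemma weighted_sum_norm_squares:
  fixes p q z :: "'b::real_inner"
  assumes "s + t \<noteq> 0"
  defines "m \<equiv> (1 / (s + t)) *\<^sub>R (s *\<^sub>R p + t *\<^sub>R q)"
  shows "s * (norm (p - z))\<^sup>2 + t * (norm (z - q))\<^sup>2
    = s * t / (s + t) * (norm (p - q))\<^sup>2 + (s + t) * (norm (m - z))\<^sup>2"
proof -
  define a b u v where "a = s / (s + t)" and "b = t / (s + t)" and "u = p - z" and "v = q - z"
  have ab: "a + b = 1" "(s + t) * (a * b) = s * t / (s + t)"
    using assms(1) by (simp_all add: a_def b_def flip: add_divide_distrib)
  have m: "m - z = a *\<^sub>R u + b *\<^sub>R v"
  proof -
    have "a *\<^sub>R u + b *\<^sub>R v = a *\<^sub>R p + b *\<^sub>R q - (a + b) *\<^sub>R z"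
      by (simp add: u_def v_def scaleR_diff_right scaleR_add_left)
    then show ?thesis
      unfolding ab(1) by (simp add: m_def a_def b_def scaleR_add_right)
  qed
  have "s * (norm (p - z))\<^sup>2 + t * (norm (z - q))\<^sup>2 = (s + t) * (a * (norm u)\<^sup>2 + b * (norm v)\<^sup>2)"
    using assms(1) by (simp add: a_def b_def u_def v_def norm_minus_commute[of z] distrib_left)
  also have "a * (norm u)\<^sup>2 + b * (norm v)\<^sup>2 = a * b * (norm (u - v))\<^sup>2 + (norm (m - z))\<^sup>2"
    using ab(1) unfolding m power2_norm_eq_inner
      inner_add_left inner_add_right inner_diff_left inner_diff_right inner_scaleR_left inner_scaleR_right
      inner_commute[of v u]
    by algebra
  also have "(s + t) * (a * b * (norm (u - v))\<^sup>2 + (norm (m - z))\<^sup>2)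
      = s * t / (s + t) * (norm (p - q))\<^sup>2 + (s + t) * (norm (m - z))\<^sup>2"
    unfolding ab(2)[symmetric] by (simp add: u_def v_def distrib_left mult.assoc)
  finally show ?thesis .
qed

lemma gaussian_mult_barycentre:
  assumes "s + t \<noteq> 0" "c \<ge> 0" "d \<ge> 0"
  shows "gaussian c s p z * gaussian d t z q
    = gaussian (c * d) (s * t / (s + t)) p q * gaussian 1 (s + t) ((1 / (s + t)) *\<^sub>R (s *\<^sub>R p + t *\<^sub>R q)) z"
proof -
  let ?m = "(1 / (s + t)) *\<^sub>R (s *\<^sub>R p + t *\<^sub>R q)"
  have "exp (- s * (norm (p - z))\<^sup>2) * exp (- t * (norm (z - q))\<^sup>2)
      = exp (- (s * (norm (p - z))\<^sup>2 + t * (norm (z - q))\<^sup>2))"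
    by (simp flip: exp_add)
  also have "\<dots> = exp (- (s * t / (s + t)) * (norm (p - q))\<^sup>2) * exp (- (s + t) * (norm (?m - z))\<^sup>2)"
    unfolding weighted_sum_norm_squares[OF assms(1)] by (simp add: algebra_simps flip: exp_add)
  finally show ?thesis
    using assms(2,3) by (simp add: gaussian_def ac_simps flip: ennreal_mult)
qed

lemma gaussian_mult_midpoint:
  assumes "s > 0"
  shows "gaussian 1 s p z * gaussian 1 s z q = gaussian 1 (s / 2) p q * gaussian 1 (2 * s) (midpoint p q) z"
proof -
  have "(1 / (s + s)) *\<^sub>R (s *\<^sub>R p + s *\<^sub>R q) = midpoint p q"
    using assms by (simp add: midpoint_def inverse_eq_divide flip: scaleR_add_right)
  then show ?thesis
    using gaussian_mult_barycentre[of s s 1 1 p z q] assms by simp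
qed

lemma nn_integral_gaussian_real:
  fixes s :: real
  assumes "s > 0"
  shows "(\<integral>\<^sup>+ t. ennreal (exp (- s * t\<^sup>2)) \<partial>lborel) = ennreal (sqrt (pi / s))"
proof -
  define \<sigma> where "\<sigma> = 1 / sqrt (2 * s)"
  have \<sigma>: "\<sigma> > 0" "\<sigma>\<^sup>2 = 1 / (2 * s)"
    using assms by (simp_all add: \<sigma>_def power_divide)
  have "ennreal (exp (- s * t\<^sup>2)) = ennreal (sqrt (pi / s)) * ennreal (normal_density 0 \<sigma> t)" for t
    using assms by (simp add: normal_density_def \<sigma> field_simps real_sqrt_divide flip: ennreal_mult)
  then have "(\<integral>\<^sup>+ t. ennreal (exp (- s * t\<^sup>2)) \<partial>lborel)
      = ennreal (sqrt (pi / s)) * (\<integral>\<^sup>+ t. ennreal (normal_density 0 \<sigma> t) \<partial>lborel)"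
    by (simp add: nn_integral_cmult)
  also have "(\<integral>\<^sup>+ t. ennreal (normal_density 0 \<sigma> t) \<partial>lborel) = 1"
    using \<sigma>(1) by (subst nn_integral_eq_integral) simp_all
  finally show ?thesis by simp
qed

lemma nn_integral_gaussian_lborel:
  fixes p :: "'b::euclidean_space"
  assumes "s > 0"
  shows "(\<integral>\<^sup>+ z. gaussian 1 s p z \<partial>lborel) = ennreal (sqrt (pi / s) ^ DIM('b))"
proof -
  have "(\<integral>\<^sup>+ z. gaussian 1 s p z \<partial>lborel) = (\<integral>\<^sup>+ z. ennreal (exp (- s * (norm z)\<^sup>2)) \<partial>(lborel :: 'b measure))"
    by (subst lborel_distr_plus[of p, symmetric], subst nn_integral_distr) (simp_all add: gaussian_def)
  also have "\<dots> = (\<integral>\<^sup>+ z. (\<Prod>b\<in>Basis. ennreal (exp (- s * (z \<bullet> b)\<^sup>2))) \<partial>(lborel :: 'b measure))"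
  proof (intro nn_integral_cong)
    fix z :: 'b
    have "exp (- s * (norm z)\<^sup>2) = (\<Prod>b\<in>Basis. exp (- s * (z \<bullet> b)\<^sup>2))"
      unfolding power2_norm_eq_inner
      by (subst euclidean_inner) (simp add: sum_distrib_left exp_sum power2_eq_square flip: sum_negf)
    then show "ennreal (exp (- s * (norm z)\<^sup>2)) = (\<Prod>b\<in>Basis. ennreal (exp (- s * (z \<bullet> b)\<^sup>2)))"
      by (simp add: prod_ennreal)
  qed
  also have "\<dots> = (\<Prod>b\<in>(Basis :: 'b set). (\<integral>\<^sup>+ t. ennreal (exp (- s * t\<^sup>2)) \<partial>lborel))"
    by (rule nn_integral_lborel_prod) simp_all
  also have "\<dots> = ennreal (sqrt (pi / s) ^ DIM('b))"
    using assms by (simp only: nn_integral_gaussian_real[OF assms] prod_constant) (simp add: ennreal_power)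
  finally show ?thesis .
qed

lemma nn_integral_gaussian:
  fixes p :: "'b::euclidean_space"
  assumes "s > 0" "c \<ge> 0" "\<rho> \<ge> 0"
  shows "(\<integral>\<^sup>+ z. gaussian c s p z \<partial>intensity_measure \<rho>) = ennreal (c * \<rho> * sqrt (pi / s) ^ DIM('b))"
proof -
  have "(\<integral>\<^sup>+ z. gaussian c s p z \<partial>intensity_measure \<rho>)
      = ennreal \<rho> * (ennreal c * (\<integral>\<^sup>+ z. gaussian 1 s p z \<partial>lborel))"
    using assms by (simp add: nn_integral_density gaussian_def ennreal_mult' nn_integral_cmult mult.left_commute)
  then show ?thesis
    using assms by (simp add: nn_integral_gaussian_lborel ac_simps flip: ennreal_mult)
qed

lemma nn_integral_gaussian_mult:
  fixes p q :: "'b::euclidean_space"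
  assumes "s + t > 0" "c \<ge> 0" "d \<ge> 0" "\<rho> \<ge> 0"
  shows "(\<integral>\<^sup>+ z. gaussian c s p z * gaussian d t z q \<partial>intensity_measure \<rho>)
    = gaussian (c * d * \<rho> * sqrt (pi / (s + t)) ^ DIM('b)) (s * t / (s + t)) p q"
proof -
  let ?m = "(1 / (s + t)) *\<^sub>R (s *\<^sub>R p + t *\<^sub>R q)" and ?r = "s * t / (s + t)"
  have "(\<integral>\<^sup>+ z. gaussian c s p z * gaussian d t z q \<partial>intensity_measure \<rho>)
      = gaussian (c * d) ?r p q * (\<integral>\<^sup>+ z. gaussian 1 (s + t) ?m z \<partial>intensity_measure \<rho>)"
    using assms by (simp add: gaussian_mult_barycentre nn_integral_cmult)
  also have "\<dots> = gaussian (c * d * \<rho> * sqrt (pi / (s + t)) ^ DIM('b)) ?r p q"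
    using assms by (simp add: nn_integral_gaussian) (simp add: gaussian_def ac_simps flip: ennreal_mult)
  finally show ?thesis .
qed

lemma nn_integral_intensity_measure_cong:
  assumes "finite S" and "\<And>z. z \<notin> S \<Longrightarrow> f z = g z"
  shows "integral\<^sup>N (intensity_measure \<rho>) f = integral\<^sup>N (intensity_measure \<rho>) g"
proof (rule nn_integral_cong_AE)
  have "AE z in lborel. z \<notin> S"
    by (rule AE_not_in[OF finite_imp_null_set_lborel[OF assms(1)]])
  then have "AE z in intensity_measure \<rho>. z \<notin> S"
    by (simp add: AE_density)
  then show "AE z in intensity_measure \<rho>. f z = g z"
    by eventually_elim (rule assms(2))
qed

lemma (in prob_space) moments_enn2real:
  fixes N :: "'a \<Rightarrow> ennreal"
  assumes [measurable]: "N \<in> borel_measurable M" and nonneg: "m \<ge> 0" "v \<ge> 0"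
    and first: "(\<integral>\<^sup>+ \<omega>. N \<omega> \<partial>M) = ennreal m" and second: "(\<integral>\<^sup>+ \<omega>. (N \<omega>)\<^sup>2 \<partial>M) = ennreal (v + m\<^sup>2)"
  shows "integrable M (\<lambda>\<omega>. enn2real (N \<omega>))" "integrable M (\<lambda>\<omega>. (enn2real (N \<omega>))\<^sup>2)"
    and "expectation (\<lambda>\<omega>. enn2real (N \<omega>)) = m" "variance (\<lambda>\<omega>. enn2real (N \<omega>)) = v"
proof -
  have "AE \<omega> in M. N \<omega> \<noteq> \<infinity>"
    using first by (intro nn_integral_PInf_AE) auto
  then have finite: "AE \<omega> in M. ennreal (enn2real (N \<omega>)) = N \<omega>"
    by eventually_elim (simp add: less_top)
  have "has_bochner_integral M (\<lambda>\<omega>. enn2real (N \<omega>)) m"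
    using nonneg(1) nn_integral_cong_AE[OF finite] first by (intro has_bochner_integral_nn_integral) simp_all
  then show int: "integrable M (\<lambda>\<omega>. enn2real (N \<omega>))" and E: "expectation (\<lambda>\<omega>. enn2real (N \<omega>)) = m"
    by (simp_all add: has_bochner_integral_iff)
  have "AE \<omega> in M. ennreal ((enn2real (N \<omega>))\<^sup>2) = (N \<omega>)\<^sup>2"
    using finite by eventually_elim (simp flip: ennreal_power)
  then have "has_bochner_integral M (\<lambda>\<omega>. (enn2real (N \<omega>))\<^sup>2) (v + m\<^sup>2)"
    using nonneg nn_integral_cong_AE second by (intro has_bochner_integral_nn_integral) fastforce+
  then show "integrable M (\<lambda>\<omega>. (enn2real (N \<omega>))\<^sup>2)" and "variance (\<lambda>\<omega>. enn2real (N \<omega>)) = v"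
    using variance_eq[OF int] E by (simp_all add: has_bochner_integral_iff)
qed

section \<open>The Gaussian connection function\<close>

locale gaussian_connection_model = poisson_process M \<rho> X
  for M :: "'a measure" and \<rho> :: real and X :: "nat \<Rightarrow> 'a \<Rightarrow> real^2" +
  fixes U :: "mark_idx \<Rightarrow> 'a \<Rightarrow> real" and \<beta> :: real and x y :: "real^2"
  assumes marks: "rcm_marks X U" and \<beta>_pos: "\<beta> > 0"
begin

sublocale random_connection_model M \<rho> X U "gaussH \<beta>" x y
proof
  show "gaussH \<beta> \<in> borel_measurable borel"
    unfolding gaussH_def by measurable
qed (use marks \<beta>_pos in \<open>simp_all add: gaussH_def\<close>)

text \<open>If there are infinitely many paths, both sides are 0.\<close>

lemma sigma3_eq_enn2real_ecard_paths: "sigma3 \<beta> x y X U \<omega> = enn2real (ecard (paths \<omega>))"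
proof -
  have "paths \<omega> = {(i, j). i \<noteq> j \<and> U (Ux i) \<omega> < gaussH \<beta> (norm (x - X i \<omega>)) \<and> edge_pts \<beta> U X i j \<omega> \<and>
      U (Uy j) \<omega> < gaussH \<beta> (norm (X j \<omega> - y))}"
    by (auto simp: paths_def all_open_def path_marks_def conn_prob_def edge_mark_def edge_pts_def min_def max_def
        norm_minus_commute)
  then show ?thesis
    by (cases "finite (paths \<omega>)") (simp_all add: sigma3_def)
qed

lemma H_eq_gaussian: "p \<noteq> q \<Longrightarrow> H p q = gaussian 1 \<beta> p q"
  by (simp add: gaussian_def gaussH_def)

lemma two_hop_eq_gaussian: "two_hop p q = gaussian (\<rho> * pi / (2 * \<beta>)) (\<beta> / 2) p q"
proof -
  have "two_hop p q = (\<integral>\<^sup>+ z. gaussian 1 \<beta> p z * gaussian 1 \<beta> z q \<partial>\<nu>)"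
    unfolding two_hop_def
    by (rule nn_integral_intensity_measure_cong[of "{p, q}"]) (auto simp: H_eq_gaussian)
  then show ?thesis
    using intensity_pos \<beta>_pos by (simp add: nn_integral_gaussian_mult)
qed

lemma three_hop_eq_gaussian:
  "(\<integral>\<^sup>+ a. H p a * two_hop a q \<partial>\<nu>) = gaussian (\<rho>\<^sup>2 * pi\<^sup>2 / (3 * \<beta>\<^sup>2)) (\<beta> / 3) p q"
proof -
  have "(\<integral>\<^sup>+ a. H p a * two_hop a q \<partial>\<nu>)
      = (\<integral>\<^sup>+ a. gaussian 1 \<beta> p a * gaussian (\<rho> * pi / (2 * \<beta>)) (\<beta> / 2) a q \<partial>\<nu>)"
    by (rule nn_integral_intensity_measure_cong[of "{p}"]) (auto simp: H_eq_gaussian two_hop_eq_gaussian)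
  also have "\<dots> = gaussian (\<rho> * pi / (2 * \<beta>) * \<rho> * (pi / (\<beta> + \<beta> / 2))) (\<beta> * (\<beta> / 2) / (\<beta> + \<beta> / 2)) p q"
    using intensity_pos \<beta>_pos by (simp add: nn_integral_gaussian_mult)
  also have "\<dots> = gaussian (\<rho>\<^sup>2 * pi\<^sup>2 / (3 * \<beta>\<^sup>2)) (\<beta> / 3) p q"
    using \<beta>_pos
    by (intro arg_cong2[where f="\<lambda>c s. gaussian c s p q"]) (simp_all add: field_simps power2_eq_square)
  finally show ?thesis .
qed

lemma common_first_eq_gaussian:
  "(\<integral>\<^sup>+ a. H p a * (two_hop a q)\<^sup>2 \<partial>\<nu>) = gaussian (\<rho> ^ 3 * pi ^ 3 / (8 * \<beta> ^ 3)) (\<beta> / 2) p q"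
proof -
  have "(\<integral>\<^sup>+ a. H p a * (two_hop a q)\<^sup>2 \<partial>\<nu>)
      = (\<integral>\<^sup>+ a. gaussian 1 \<beta> p a * gaussian ((\<rho> * pi / (2 * \<beta>))\<^sup>2) \<beta> a q \<partial>\<nu>)"
    using intensity_pos \<beta>_pos
    by (intro nn_integral_intensity_measure_cong[of "{p}"])
      (auto simp: H_eq_gaussian two_hop_eq_gaussian gaussian_mult power2_eq_square)
  also have "\<dots> = gaussian ((\<rho> * pi / (2 * \<beta>))\<^sup>2 * \<rho> * (pi / (\<beta> + \<beta>))) (\<beta> * \<beta> / (\<beta> + \<beta>)) p q"
    using intensity_pos \<beta>_pos by (simp add: nn_integral_gaussian_mult)
  also have "\<dots> = gaussian (\<rho> ^ 3 * pi ^ 3 / (8 * \<beta> ^ 3)) (\<beta> / 2) p q"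
    using \<beta>_pos
    by (intro arg_cong2[where f="\<lambda>c s. gaussian c s p q"])
      (simp_all add: field_simps power2_eq_square power3_eq_cube)
  finally show ?thesis .
qed

lemma common_last_eq_gaussian:
  "(\<integral>\<^sup>+ a. H a q * (two_hop p a)\<^sup>2 \<partial>\<nu>) = gaussian (\<rho> ^ 3 * pi ^ 3 / (8 * \<beta> ^ 3)) (\<beta> / 2) p q"
proof -
  have "(\<integral>\<^sup>+ a. H a q * (two_hop p a)\<^sup>2 \<partial>\<nu>) = (\<integral>\<^sup>+ a. H q a * (two_hop a p)\<^sup>2 \<partial>\<nu>)"
    by (simp only: H_commute[of q] two_hop_eq_gaussian gaussian_commute[of _ _ p])
  then show ?thesis
    by (simp only: common_first_eq_gaussian gaussian_commute[of _ _ q])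
qed

lemma chained_eq_gaussian:
  "(\<integral>\<^sup>+ a. H p a * H a q * (two_hop p a * two_hop a q) \<partial>\<nu>)
    = gaussian (\<rho> ^ 3 * pi ^ 3 / (12 * \<beta> ^ 3)) (3 * \<beta> / 4) p q"
proof -
  let ?\<kappa> = "\<rho> * pi / (2 * \<beta>)"
  have "(\<integral>\<^sup>+ a. H p a * H a q * (two_hop p a * two_hop a q) \<partial>\<nu>)
      = (\<integral>\<^sup>+ a. gaussian ?\<kappa> (\<beta> + \<beta> / 2) p a * gaussian ?\<kappa> (\<beta> + \<beta> / 2) a q \<partial>\<nu>)"
  proof (rule nn_integral_intensity_measure_cong[of "{p, q}"])
    fix a assume "a \<notin> {p, q}"
    then have "H p a * H a q * (two_hop p a * two_hop a q)
        = (gaussian 1 \<beta> p a * gaussian ?\<kappa> (\<beta> / 2) p a) * (gaussian 1 \<beta> a q * gaussian ?\<kappa> (\<beta> / 2) a q)"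
      by (auto simp: H_eq_gaussian two_hop_eq_gaussian ac_simps)
    then show "H p a * H a q * (two_hop p a * two_hop a q)
        = gaussian ?\<kappa> (\<beta> + \<beta> / 2) p a * gaussian ?\<kappa> (\<beta> + \<beta> / 2) a q"
      using intensity_pos \<beta>_pos by (simp only: gaussian_mult) (simp add: gaussian_mult)
  qed simp
  also have "\<dots> = gaussian (?\<kappa> * ?\<kappa> * \<rho> * (pi / (\<beta> + \<beta> / 2 + (\<beta> + \<beta> / 2))))
      ((\<beta> + \<beta> / 2) * (\<beta> + \<beta> / 2) / (\<beta> + \<beta> / 2 + (\<beta> + \<beta> / 2))) p q"
    using intensity_pos \<beta>_pos by (simp add: nn_integral_gaussian_mult)
  also have "\<dots> = gaussian (\<rho> ^ 3 * pi ^ 3 / (12 * \<beta> ^ 3)) (3 * \<beta> / 4) p q"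
    using \<beta>_pos
    by (intro arg_cong2[where f="\<lambda>c s. gaussian c s p q"])
      (simp_all add: field_simps power2_eq_square power3_eq_cube)
  finally show ?thesis .
qed

lemma common_neighbours_eq_gaussian:
  "(\<integral>\<^sup>+ b. H p b * H b q * H b a \<partial>\<nu>)
    = gaussian 1 (\<beta> / 2) p q * gaussian (\<rho> * pi / (3 * \<beta>)) (2 * \<beta> / 3) (midpoint p q) a"
proof -
  let ?g = "gaussian 1 (\<beta> / 2) p q" and ?m = "midpoint p q"
  have "(\<integral>\<^sup>+ b. H p b * H b q * H b a \<partial>\<nu>) = (\<integral>\<^sup>+ b. ?g * (gaussian 1 (2 * \<beta>) ?m b * gaussian 1 \<beta> b a) \<partial>\<nu>)"
    using \<beta>_pos
    by (intro nn_integral_intensity_measure_cong[of "{p, q, a}"])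
      (auto simp: H_eq_gaussian gaussian_mult_midpoint simp flip: mult.assoc)
  also have "\<dots> = ?g * gaussian (\<rho> * (pi / (2 * \<beta> + \<beta>))) (2 * \<beta> * \<beta> / (2 * \<beta> + \<beta>)) ?m a"
    using intensity_pos \<beta>_pos by (simp add: nn_integral_cmult nn_integral_gaussian_mult)
  finally show ?thesis
    using \<beta>_pos by (simp add: field_simps)
qed

lemma reversed_eq_gaussian:
  "(\<integral>\<^sup>+ a. H p a * H a q * (\<integral>\<^sup>+ b. H p b * H b q * H b a \<partial>\<nu>) \<partial>\<nu>)
    = gaussian (\<rho>\<^sup>2 * pi\<^sup>2 / (8 * \<beta>\<^sup>2)) \<beta> p q"
proof -
  let ?g = "gaussian 1 (\<beta> / 2) p q" and ?m = "midpoint p q"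
  have "(\<integral>\<^sup>+ a. H p a * H a q * (\<integral>\<^sup>+ b. H p b * H b q * H b a \<partial>\<nu>) \<partial>\<nu>)
      = (\<integral>\<^sup>+ a. ?g * ?g * (gaussian 1 (2 * \<beta>) ?m a * gaussian (\<rho> * pi / (3 * \<beta>)) (2 * \<beta> / 3) ?m a) \<partial>\<nu>)"
    unfolding common_neighbours_eq_gaussian
  proof (rule nn_integral_intensity_measure_cong[of "{p, q}"])
    fix a assume "a \<notin> {p, q}"
    then have "H p a * H a q = ?g * gaussian 1 (2 * \<beta>) ?m a"
      using \<beta>_pos by (auto simp: H_eq_gaussian gaussian_mult_midpoint)
    then show "H p a * H a q * (?g * gaussian (\<rho> * pi / (3 * \<beta>)) (2 * \<beta> / 3) ?m a)
        = ?g * ?g * (gaussian 1 (2 * \<beta>) ?m a * gaussian (\<rho> * pi / (3 * \<beta>)) (2 * \<beta> / 3) ?m a)"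
      by (simp only: ac_simps)
  qed simp
  also have "\<dots> = gaussian 1 \<beta> p q * ennreal (\<rho> * pi / (3 * \<beta>) * \<rho> * (pi / (2 * \<beta> + 2 * \<beta> / 3)))"
    using intensity_pos \<beta>_pos by (simp add: gaussian_mult nn_integral_cmult nn_integral_gaussian)
  also have "\<dots> = gaussian (\<rho>\<^sup>2 * pi\<^sup>2 / (8 * \<beta>\<^sup>2)) \<beta> p q"
    using intensity_pos \<beta>_pos by (simp add: gaussian_def power2_eq_square field_simps flip: ennreal_mult)
  finally show ?thesis .
qed

end

theorem mainTheorem3:
  fixes M :: "'a measure" and \<rho> \<beta> :: real and x y :: "real^2"
    and X :: "nat \<Rightarrow> 'a \<Rightarrow> real^2" and U :: "mark_idx \<Rightarrow> 'a \<Rightarrow> real"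
  assumes "prob_space M"
    and "\<rho> > 0" and "\<beta> > 0" and "x \<noteq> y"
    and "prob_space.poisson_pp M \<rho> X"
    and "prob_space.rcm_marks M X U"
  shows "integrable M (sigma3 \<beta> x y X U)
    \<and> integrable M (\<lambda>\<omega>. (sigma3 \<beta> x y X U \<omega>)\<^sup>2)
    \<and> prob_space.expectation M (sigma3 \<beta> x y X U)
        = pi\<^sup>2 * \<rho>\<^sup>2 / (3 * \<beta>\<^sup>2) * exp (- \<beta> * (norm (x - y))\<^sup>2 / 3)
    \<and> prob_space.variance M (sigma3 \<beta> x y X U)
        = prob_space.expectation M (sigma3 \<beta> x y X U)
          + pi ^ 3 * \<rho> ^ 3 / \<beta> ^ 3 *
              (1/4 * exp (- \<beta> * (norm (x - y))\<^sup>2 / 2) + 1/6 * exp (- 3 * \<beta> * (norm (x - y))\<^sup>2 / 4))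
          + pi\<^sup>2 * \<rho>\<^sup>2 / (8 * \<beta>\<^sup>2) * exp (- \<beta> * (norm (x - y))\<^sup>2)"
    (is "_ \<and> _ \<and> _ = ?mean \<and> _ = _ + ?common_vertex + ?reversed")
proof -
  interpret prob_space M by fact
  interpret gaussian_connection_model M \<rho> X U \<beta> x y
    by unfold_locales (use assms in simp_all)
  have nonneg: "?mean \<ge> 0" "?common_vertex \<ge> 0" "?reversed \<ge> 0"
    using assms(2,3) by simp_all
  have first: "(\<integral>\<^sup>+ \<omega>. ecard (paths \<omega>) \<partial>M) = ennreal ?mean"
    unfolding nn_integral_ecard_paths three_hop_eq_gaussian by (simp add: gaussian_def mult.commute)
  have second: "(\<integral>\<^sup>+ \<omega>. (ecard (paths \<omega>))\<^sup>2 \<partial>M) = ennreal (?mean + ?common_vertex + ?reversed + ?mean\<^sup>2)"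
    unfolding nn_integral_ecard_paths_square three_hop_eq_gaussian reversed_eq_gaussian
      common_first_eq_gaussian common_last_eq_gaussian chained_eq_gaussian
    using assms(2,3) nonneg
    by (simp add: gaussian_def ennreal_power field_simps flip: ennreal_plus ennreal_mult ennreal_numeral)
  show ?thesis
    using moments_enn2real[OF borel_measurable_ecard_paths _ _ first second] nonneg
    by (simp add: sigma3_eq_enn2real_ecard_paths[abs_def])
qed

end
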